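(* Let $\mathcal{P}$ be a finite chiral $n$-polytope, and let $\mathcal{Q}$ be a finite chiral $n$-polytope such that $\Gamma^+(\mathcal{Q})$ is simple. If $X(\mathcal{P})$ is not isomorphic to $\Gamma^+(\mathcal{Q})$, then $\mathcal{P}\diamond\mathcal{Q}$ is chiral.
   Context: All polytopes are abstract polytopes. A polytope is chiral if its automorphism group has two orbits on flags, adjacent flags lying in distinct orbits; then $\Gamma^+(\mathcal{P})$ is its automorphism group, generated by standard rotations $\sigma_1,\dots,\sigma_{n-1}$ relative to a base flag. Let $W^+=\langle \sigma_1,\dots,\sigma_{n-1}\mid (\sigma_i\cdots\sigma_j)^2=1,\ 1\le i<j\le n-1\rangle$; then $\Gamma^+(\mathcal{P})=W^+/M$ for a normal subgroup $M$, generators corresponding. Let $w\mapsto\overline{w}$ be the automorphism of $W^+$ with $\sigma_1\mapsto\sigma_1^{-1}$, $\sigma_2\mapsto\sigma_1^2\sigma_2$, $\sigma_j\mapsto\sigma_j$ ($j\ge3$), and $\overline M$ the image of $M$. Mix: if $\Gamma^+(\mathcal{P})=W^+/M$ and $\Gamma^+(\mathcal{Q})=W^+/K$, the mix $\mathcal{P}\diamond\mathcal{Q}$ is the (flag-connected pre-)polytope whose rotation group is the subgroup of $\Gamma^+(\mathcal{P})\times\Gamma^+(\mathcal{Q})$ generated by $(\sigma_i,\sigma_i')$, isomorphic to $W^+/N$ with $N=M\cap K$; it is chiral if $\overline N\ne N$ and directly regular otherwise. Chirality group: $X(\mathcal{P})=M\overline{M}/M$, the kernel of the natural epimorphism $W^+/M\to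 W^+/(M\overline M)$ (isomorphic to the kernel of the natural epimorphism $W^+/(M\cap\overline M)\to W^+/M$). *)

theory Defs
  imports "HOL-Algebra.Algebra"
begin

section \<open>Abstract polytopes\<close>

text \<open>
  A poset is given by its (reflexive) order relation \<^term>\<open>P\<close>; its faces are the elements
  of \<^term>\<open>Field P\<close>.
\<close>

definition flags :: "'a rel \<Rightarrow> 'a set set" where
  "flags P = {\<Phi> \<in> Chains P. \<forall>\<Psi> \<in> Chains P. \<Phi> \<subseteq> \<Psi> \<longrightarrow> \<Psi> = \<Phi>}"

text \<open>
  The position of a face in a flag through it, the least face having rank \<open>-1\<close>. When all flags
  have the same finite size, the value does not depend on the chosen flag.
\<close>

definition face_rank :: "'a rel \<Rightarrow> 'a \<Rightarrow> int" where
  "face_rank P F =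
     int (card {G \<in> (SOME \<Phi>. \<Phi> \<in> flags P \<and> F \<in> \<Phi>). (G, F) \<in> P \<and> G \<noteq> F}) - 1"

definition adjacent_flags :: "'a rel \<Rightarrow> nat \<Rightarrow> 'a set \<Rightarrow> 'a set \<Rightarrow> bool" where
  "adjacent_flags P i \<Phi> \<Psi> \<longleftrightarrow>
     \<Phi> \<in> flags P \<and> \<Psi> \<in> flags P \<and> \<Phi> \<noteq> \<Psi> \<and>
     {F \<in> \<Phi>. face_rank P F \<noteq> int i} = {F \<in> \<Psi>. face_rank P F \<noteq> int i}"

definition strongly_flag_connected :: "'a rel \<Rightarrow> bool" where
  "strongly_flag_connected P \<longleftrightarrow>
     (\<forall>\<Phi> \<in> flags P. \<forall>\<Psi> \<in> flags P.
        (\<Phi>, \<Psi>) \<in> {(\<Gamma>, \<Delta>). \<Phi> \<inter> \<Psi> \<subseteq> \<Gamma> \<and> \<Phi> \<inter> \<Psi> \<subseteq> \<Delta> \<and> (\<exists>i. adjacent_flags P i \<Gamma> \<Delta>)}\<^sup>*)"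

definition abstract_polytope :: "nat \<Rightarrow> 'a rel \<Rightarrow> bool" where
  "abstract_polytope n P \<longleftrightarrow>
     Partial_order P \<and>
     (\<exists>b \<in> Field P. \<forall>F \<in> Field P. (b, F) \<in> P) \<and>
     (\<exists>t \<in> Field P. \<forall>F \<in> Field P. (F, t) \<in> P) \<and>
     (\<forall>\<Phi> \<in> flags P. finite \<Phi> \<and> card \<Phi> = n + 2) \<and>
     (\<forall>F G. (F, G) \<in> P \<and> face_rank P G = face_rank P F + 2 \<longrightarrow>
        card {H. (F, H) \<in> P \<and> (H, G) \<in> P \<and> H \<noteq> F \<and> H \<noteq> G} = 2) \<and>
     strongly_flag_connected P"

text \<open>The flag that differs from \<open>\<Phi>\<close> exactly in its face of rank \<open>i\<close>.\<close>

definition adj :: "'a rel \<Rightarrow> nat \<Rightarrow> 'a set \<Rightarrow> 'a set" where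
  "adj P i \<Phi> = (THE \<Psi>. adjacent_flags P i \<Phi> \<Psi>)"

text \<open>
  Automorphisms act on the right: the product of \<open>f\<close> and \<open>g\<close> applies \<open>f\<close> first. As in
  \<^const>\<open>BijGroup\<close>, maps are extensional so that an automorphism is determined by its values
  on faces.
\<close>

definition aut_group :: "'a rel \<Rightarrow> ('a \<Rightarrow> 'a) monoid" where
  "aut_group P =
     \<lparr>carrier = {f \<in> Bij (Field P). \<forall>x \<in> Field P. \<forall>y \<in> Field P. (f x, f y) \<in> P \<longleftrightarrow> (x, y) \<in> P},
      monoid.mult = (\<lambda>f g. compose (Field P) g f),
      one = (\<lambda>x \<in> Field P. x)\<rparr>"

definition chiral_polytope :: "nat \<Rightarrow> 'a rel \<Rightarrow> bool" where
  "chiral_polytope n P \<longleftrightarrow>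
     abstract_polytope n P \<and>
     card (orbits (aut_group P) (flags P) (\<lambda>f \<Phi>. f ` \<Phi>)) = 2 \<and>
     (\<forall>i \<Phi> \<Psi>. adjacent_flags P i \<Phi> \<Psi> \<longrightarrow>
        orbit (aut_group P) (\<lambda>f \<Phi>. f ` \<Phi>) \<Phi> \<noteq> orbit (aut_group P) (\<lambda>f \<Phi>. f ` \<Phi>) \<Psi>)"

text \<open>
  The standard rotation \<open>\<sigma>\<^sub>i\<close> relative to the base flag \<open>\<Phi>\<close> is the automorphism with
  \<open>\<Phi> \<sigma>\<^sub>i = \<Phi>\<^sup>i\<^sup>,\<^sup>i\<^sup>-\<^sup>1 = (\<Phi>\<^sup>i)\<^sup>i\<^sup>-\<^sup>1\<close>. In a chiral polytope it exists for \<open>1 \<le> i \<le> n - 1\<close>, since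
  \<open>\<Phi>\<close> and \<open>\<Phi>\<^sup>i\<^sup>,\<^sup>i\<^sup>-\<^sup>1\<close> then lie in the same orbit, and is unique, since an automorphism fixing a
  flag is trivial.
\<close>

definition std_rot :: "'a rel \<Rightarrow> 'a set \<Rightarrow> nat \<Rightarrow> 'a \<Rightarrow> 'a" where
  "std_rot P \<Phi> i = (THE f. f \<in> carrier (aut_group P) \<and> f ` \<Phi> = adj P (i - 1) (adj P i \<Phi>))"


section \<open>Groups given by generators and relators\<close>

text \<open>
  In a word, \<open>(s, True)\<close> stands for the generator \<open>s\<close> and \<open>(s, False)\<close> for its inverse.
  Two words over \<open>S\<close> are related if they represent the same element of \<open>\<langle>S | R\<rangle>\<close>.
\<close>

inductive word_eq :: "'s set \<Rightarrow> ('s \<times> bool) list set \<Rightarrow> ('s \<times> bool) list \<Rightarrow> ('s \<times> bool) list \<Rightarrow> bool"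
  for S R where
  refl: "u \<in> lists (S \<times> UNIV) \<Longrightarrow> word_eq S R u u"
| sym: "word_eq S R u v \<Longrightarrow> word_eq S R v u"
| trans: "word_eq S R u v \<Longrightarrow> word_eq S R v w \<Longrightarrow> word_eq S R u w"
| cancel: "\<lbrakk>u \<in> lists (S \<times> UNIV); v \<in> lists (S \<times> UNIV); s \<in> S\<rbrakk>
    \<Longrightarrow> word_eq S R (u @ [(s, b), (s, \<not> b)] @ v) (u @ v)"
| relator: "\<lbrakk>u \<in> lists (S \<times> UNIV); v \<in> lists (S \<times> UNIV); r \<in> R; r \<in> lists (S \<times> UNIV)\<rbrakk>
    \<Longrightarrow> word_eq S R (u @ r @ v) (u @ v)"

definition presented_group ::
    "'s set \<Rightarrow> ('s \<times> bool) list set \<Rightarrow> ('s \<times> bool) list set monoid" where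
  "presented_group S R =
     \<lparr>carrier = lists (S \<times> UNIV) // {(u, v). word_eq S R u v},
      monoid.mult = (\<lambda>A B. {w. \<exists>u \<in> A. \<exists>v \<in> B. word_eq S R (u @ v) w}),
      one = {w. word_eq S R [] w}\<rparr>"

definition word_val :: "('g, 'b) monoid_scheme \<Rightarrow> ('s \<Rightarrow> 'g) \<Rightarrow> ('s \<times> bool) list \<Rightarrow> 'g" where
  "word_val G f w =
     foldr (\<lambda>(s, b) x. (if b then f s else inv\<^bsub>G\<^esub> f s) \<otimes>\<^bsub>G\<^esub> x) w \<one>\<^bsub>G\<^esub>"

text \<open>
  The homomorphism from a presented group to \<open>G\<close> that sends each generator \<open>s\<close> to \<open>f s\<close>, in
  case the elements \<open>f s\<close> of \<open>G\<close> satisfy the relations (so that the representative is immaterial).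
\<close>

definition presented_hom ::
    "('g, 'b) monoid_scheme \<Rightarrow> ('s \<Rightarrow> 'g) \<Rightarrow> ('s \<times> bool) list set \<Rightarrow> 'g" where
  "presented_hom G f C = word_val G f (SOME w. w \<in> C)"


section \<open>Rotation groups, the mix, and chirality groups\<close>

definition W_relators :: "nat \<Rightarrow> (nat \<times> bool) list set" where
  "W_relators n =
     {r @ r | r. \<exists>i j. 1 \<le> i \<and> i < j \<and> j < n \<and> r = map (\<lambda>k. (k, True)) [i..<Suc j]}"

definition Wplus :: "nat \<Rightarrow> (nat \<times> bool) list set monoid" where
  "Wplus n = presented_group {1..<n} (W_relators n)"

definition W_gen :: "nat \<Rightarrow> nat \<Rightarrow> (nat \<times> bool) list set" where
  "W_gen n i = {w. word_eq {1..<n} (W_relators n) [(i, True)] w}"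

text \<open>
  The bar automorphism of \<open>W\<^sup>+\<close>, defined by \<open>\<sigma>\<^sub>1 \<mapsto> \<sigma>\<^sub>1\<^sup>-\<^sup>1\<close>, \<open>\<sigma>\<^sub>2 \<mapsto> \<sigma>\<^sub>1\<^sup>2\<sigma>\<^sub>2\<close> and
  \<open>\<sigma>\<^sub>j \<mapsto> \<sigma>\<^sub>j\<close> for \<open>j \<ge> 3\<close>.
\<close>

definition W_bar :: "nat \<Rightarrow> (nat \<times> bool) list set \<Rightarrow> (nat \<times> bool) list set" where
  "W_bar n = presented_hom (Wplus n)
     (\<lambda>i. if i = 1 then inv\<^bsub>Wplus n\<^esub> W_gen n 1
          else if i = 2 then W_gen n 1 \<otimes>\<^bsub>Wplus n\<^esub> W_gen n 1 \<otimes>\<^bsub>Wplus n\<^esub> W_gen n 2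
          else W_gen n i)"

text \<open>The normal subgroup \<open>M\<close> such that \<open>W\<^sup>+/M\<close> is \<open>G = \<langle>f 1, \<dots>, f (n - 1)\<rangle>\<close>, generators corresponding.\<close>

definition W_kernel :: "nat \<Rightarrow> ('g, 'b) monoid_scheme \<Rightarrow> (nat \<Rightarrow> 'g) \<Rightarrow> (nat \<times> bool) list set set" where
  "W_kernel n G f = kernel (Wplus n) G (presented_hom G f)"

text \<open>
  The rotation group of a chiral polytope is its full automorphism group. Everything below is
  taken relative to a base flag \<open>\<Phi>\<close> of \<open>P\<close> and a base flag \<open>\<Psi>\<close> of \<open>Q\<close>.
\<close>

definition chirality_group ::
    "nat \<Rightarrow> 'a rel \<Rightarrow> 'a set \<Rightarrow> (nat \<times> bool) list set set monoid" where
  "chirality_group n P \<Phi> =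
     (let M = W_kernel n (aut_group P) (std_rot P \<Phi>)
      in (Wplus n)\<lparr>carrier := M <#>\<^bsub>Wplus n\<^esub> (W_bar n ` M)\<rparr> Mod M)"

definition mix_group ::
    "nat \<Rightarrow> 'a rel \<Rightarrow> 'a set \<Rightarrow> 'b rel \<Rightarrow> 'b set \<Rightarrow> (('a \<Rightarrow> 'a) \<times> ('b \<Rightarrow> 'b)) monoid" where
  "mix_group n P \<Phi> Q \<Psi> =
     subgroup_generated (aut_group P \<times>\<times> aut_group Q)
       {(std_rot P \<Phi> i, std_rot Q \<Psi> i) | i. i \<in> {1..<n}}"

text \<open>
  The mix need not be a polytope; it is determined by its rotation group together with the
  generators, and its chirality is defined through the corresponding subgroup of \<open>W\<^sup>+\<close>.
\<close>

definition mix_chiral :: "nat \<Rightarrow> 'a rel \<Rightarrow> 'a set \<Rightarrow> 'b rel \<Rightarrow> 'b set \<Rightarrow> bool" where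
  "mix_chiral n P \<Phi> Q \<Psi> \<longleftrightarrow>
     (let N = W_kernel n (mix_group n P \<Phi> Q \<Psi>) (\<lambda>i. (std_rot P \<Phi> i, std_rot Q \<Psi> i))
      in W_bar n ` N \<noteq> N)"

end

theory Submission
  imports Defs
begin

text \<open>
  Write \<open>\<Gamma>\<^sup>+(P) = W\<^sup>+/M\<close> and \<open>\<Gamma>\<^sup>+(Q) = W\<^sup>+/K\<close>, and suppose that \<open>N = M \<inter> K\<close> is bar-invariant. Since \<open>P\<close> is
  chiral, \<open>M\<close> is not contained in \<open>\<beta>(M)\<close>, where \<open>\<beta>\<close> is the (involutory) bar automorphism; in particular
  \<open>N \<noteq> M\<close>, so the simple group \<open>\<Gamma>\<^sup>+(Q)\<close> is the image of \<open>M\<close> and \<open>M/N \<cong> \<Gamma>\<^sup>+(Q)\<close>. The normal subgroup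
  \<open>M \<inter> \<beta>(M)\<close> lies between \<open>N\<close> and \<open>M\<close>, so by simplicity it equals \<open>N\<close>. Hence
  \<open>X(P) = M \<beta>(M)/M \<cong> \<beta>(M)/(M \<inter> \<beta>(M)) = \<beta>(M)/\<beta>(N) \<cong> M/N \<cong> \<Gamma>\<^sup>+(Q)\<close>.
\<close>

section \<open>Flags, ranks and adjacency\<close>

text \<open>The obstacle is the failure of bar-invariance of \<open>M\<close>: chirality speaks of
  flag orbits, whereas the bar map only rewrites words in the generators. The link is a reflection
  that a chiral polytope does not have, the one exchanging the base flag \<Phi> with its 0-adjacent
  flag: the bar map is what conjugation by it would induce. If \<open>M\<close> were invariant, this
  reflection could be built as a map on flags. Turning that map into one on faces requires
  well-defined ranks, flags read as sequences of faces, and strong connectivity, hence the long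
  combinatorial preparation. Excluding the equality of \<open>M\<close> and
  \<beta>(\<open>M\<close>) also excludes the inclusion, because applying the involution \<beta> to
  it yields the reverse inclusion. The same combinatorics shows that the standard rotations satisfy
  the relations of \<open>W\<^sup>+\<close> and generate all automorphisms. For \<open>Q\<close>
  this makes the projection from \<open>W\<^sup>+\<close> surjective, so that images of normal
  subgroups are normal and simplicity can be applied to them.\<close>

locale polytope =
  fixes n :: nat and P :: "'a rel"
  assumes abstract_polytope: "abstract_polytope n P"
begin

section \<open>Order axioms, flags as maximal chains, and ranks\<close>

lemma refl: "x \<in> Field P \<Longrightarrow> (x, x) \<in> P"
  using abstract_polytope unfolding abstract_polytope_def order_on_defs by (blast dest: refl_onD)

lemma trans: "\<lbrakk>(x, y) \<in> P; (y, z) \<in> P\<rbrakk> \<Longrightarrow> (x, z) \<in> P"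
  using abstract_polytope unfolding abstract_polytope_def order_on_defs by (meson transD)

lemma antisym: "\<lbrakk>(x, y) \<in> P; (y, x) \<in> P\<rbrakk> \<Longrightarrow> x = y"
  using abstract_polytope unfolding abstract_polytope_def order_on_defs by (meson antisymD)

lemma in_Field: "(x, y) \<in> P \<Longrightarrow> x \<in> Field P" "(x, y) \<in> P \<Longrightarrow> y \<in> Field P"
  by (auto simp: Field_def)

lemma flag_finite: "\<Phi> \<in> flags P \<Longrightarrow> finite \<Phi>"
  and flag_card: "\<Phi> \<in> flags P \<Longrightarrow> card \<Phi> = n + 2"
  using abstract_polytope by (auto simp: abstract_polytope_def)

lemma diamond:
  "\<lbrakk>(F, G) \<in> P; face_rank P G = face_rank P F + 2\<rbrakk>
    \<Longrightarrow> card {H. (F, H) \<in> P \<and> (H, G) \<in> P \<and> H \<noteq> F \<and> H \<noteq> G} = 2"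
  using abstract_polytope by (auto simp: abstract_polytope_def)

lemma flag_comparable: "\<lbrakk>\<Phi> \<in> flags P; F \<in> \<Phi>; G \<in> \<Phi>\<rbrakk> \<Longrightarrow> (F, G) \<in> P \<or> (G, F) \<in> P"
  by (auto simp: flags_def Chains_def)

lemma flag_subset: "\<Phi> \<in> flags P \<Longrightarrow> \<Phi> \<subseteq> Field P"
  using flag_comparable in_Field by blast

lemma flag_memI:
  assumes "\<Phi> \<in> flags P" "F \<in> Field P" "\<And>G. G \<in> \<Phi> \<Longrightarrow> (F, G) \<in> P \<or> (G, F) \<in> P"
  shows "F \<in> \<Phi>"
proof -
  have "insert F \<Phi> \<in> Chains P"
    using assms refl flag_comparable[OF assms(1)] by (auto simp: Chains_def)
  then show ?thesis using assms(1) by (auto simp: flags_def)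
qed

lemma extend_to_flag:
  assumes "C \<in> Chains P"
  obtains \<Phi> where "\<Phi> \<in> flags P" "C \<subseteq> \<Phi>"
proof -
  let ?A = "{D \<in> Chains P. C \<subseteq> D}"
  have "\<exists>M\<in>{D \<in> Chains P. C \<subseteq> D}. \<forall>Z\<in>{D \<in> Chains P. C \<subseteq> D}. M \<subseteq> Z \<longrightarrow> Z = M"
  proof (rule subset_Zorn_nonempty)
    show "?A \<noteq> {}" using assms by auto
    fix \<C> assume ne: "\<C> \<noteq> {}" and ch: "subset.chain ?A \<C>"
    have "(x, y) \<in> P \<or> (y, x) \<in> P" if "x \<in> Z" "y \<in> Y" "Z \<in> \<C>" "Y \<in> \<C>" for x y Z Y
    proof -
      have "Z \<subseteq> Y \<or> Y \<subseteq> Z" "Z \<in> Chains P" "Y \<in> Chains P"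
        using ch that unfolding subset.chain_def by blast+
      then show ?thesis using that by (auto simp: Chains_def)
    qed
    then have "\<Union>\<C> \<in> Chains P" by (auto simp: Chains_def)
    moreover have "C \<subseteq> \<Union>\<C>" using ne ch unfolding subset.chain_def by blast
    ultimately show "\<Union>\<C> \<in> ?A" by simp
  qed
  then obtain M where "M \<in> ?A" "\<forall>Z\<in>?A. M \<subseteq> Z \<longrightarrow> Z = M" by blast
  then have "M \<in> flags P" "C \<subseteq> M" by (auto simp: flags_def)
  then show ?thesis by (rule that)
qed

text \<open>A chain of size \<open>n + 2\<close> fills any flag containing it, since flags have
  exactly that size. New flags are recognised this way, by counting instead of checking
  maximality.\<close>

lemma chain_flagI:
  assumes "C \<in> Chains P" "card C = n + 2"
  shows "C \<in> flags P"
proof -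
  obtain \<Phi> where \<Phi>: "\<Phi> \<in> flags P" "C \<subseteq> \<Phi>" using extend_to_flag[OF assms(1)] .
  then have "C = \<Phi>" using flag_finite flag_card assms(2) by (simp add: card_subset_eq)
  then show ?thesis using \<Phi> by simp
qed

lemma flag_through:
  assumes "(F, G) \<in> P"
  obtains \<Phi> where "\<Phi> \<in> flags P" "F \<in> \<Phi>" "G \<in> \<Phi>"
proof -
  have "{F, G} \<in> Chains P" using assms refl in_Field[OF assms] by (auto simp: Chains_def)
  then show ?thesis using extend_to_flag that by (metis insert_subset)
qed

text \<open>Take a flag \<Theta> containing the spliced chain. A face of \<Theta> below
  \<open>F\<close> is comparable to the lower half of \<Phi>, which lies in \<Theta>, and through
  \<open>F\<close> to the upper half; so it belongs to \<Phi> by maximality. Faces above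
  \<open>F\<close> belong to \<Psi> in the same way, and \<Theta> is no larger than the
  splice.\<close>

lemma flag_splice:
  assumes \<Phi>: "\<Phi> \<in> flags P" and \<Psi>: "\<Psi> \<in> flags P" and F: "F \<in> \<Phi>" "F \<in> \<Psi>"
  shows "{G \<in> \<Phi>. (G, F) \<in> P} \<union> {G \<in> \<Psi>. (F, G) \<in> P} \<in> flags P" (is "?C \<in> _")
proof -
  have "?C \<in> Chains P"
    using flag_comparable[OF \<Phi>] flag_comparable[OF \<Psi>] trans by (auto simp: Chains_def)
  then obtain \<Theta> where \<Theta>: "\<Theta> \<in> flags P" "?C \<subseteq> \<Theta>" by (rule extend_to_flag)
  have F\<Theta>: "F \<in> \<Theta>" using F flag_subset[OF \<Phi>] refl \<Theta> by auto
  have "x \<in> ?C" if x: "x \<in> \<Theta>" for x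
  proof -
    have xF: "x \<in> Field P" using x flag_subset[OF \<Theta>(1)] by auto
    consider "(x, F) \<in> P" | "(F, x) \<in> P" using flag_comparable[OF \<Theta>(1) x F\<Theta>] by auto
    then show ?thesis
    proof cases
      case 1
      have "x \<in> \<Phi>"
      proof (rule flag_memI[OF \<Phi> xF])
        fix G assume G: "G \<in> \<Phi>"
        then consider "(G, F) \<in> P" | "(F, G) \<in> P" using flag_comparable[OF \<Phi> _ F(1)] by auto
        then show "(x, G) \<in> P \<or> (G, x) \<in> P"
        proof cases
          assume "(G, F) \<in> P"
          then have "G \<in> \<Theta>" using G \<Theta> by auto
          then show ?thesis using flag_comparable[OF \<Theta>(1) x] by auto
        next
          assume "(F, G) \<in> P"
          then show ?thesis using trans 1 by blast
        qed
      qed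
      then show ?thesis using 1 by simp
    next
      case 2
      have "x \<in> \<Psi>"
      proof (rule flag_memI[OF \<Psi> xF])
        fix G assume G: "G \<in> \<Psi>"
        then consider "(G, F) \<in> P" | "(F, G) \<in> P" using flag_comparable[OF \<Psi> _ F(2)] by auto
        then show "(x, G) \<in> P \<or> (G, x) \<in> P"
        proof cases
          assume "(F, G) \<in> P"
          then have "G \<in> \<Theta>" using G \<Theta> by auto
          then show ?thesis using flag_comparable[OF \<Theta>(1) x] by auto
        next
          assume "(G, F) \<in> P"
          then show ?thesis using trans 2 by blast
        qed
      qed
      then show ?thesis using 2 by simp
    qed
  qed
  then have "?C = \<Theta>" using \<Theta>(2) by blast
  then show ?thesis using \<Theta>(1) by simp
qed

text \<open>Splicing either lower part with the upper part of \<Psi> gives a flag, and all flags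
  have \<open>n + 2\<close> faces; so the two lower parts have equal size. This makes
  \<open>face_rank\<close> independent of the flag chosen in its definition.\<close>

lemma card_below_unique:
  assumes \<Phi>: "\<Phi> \<in> flags P" and \<Psi>: "\<Psi> \<in> flags P" and F: "F \<in> \<Phi>" "F \<in> \<Psi>"
  shows "card {G \<in> \<Phi>. (G, F) \<in> P \<and> G \<noteq> F} = card {G \<in> \<Psi>. (G, F) \<in> P \<and> G \<noteq> F}"
proof -
  have split: "card {G \<in> \<Lambda>. (G, F) \<in> P \<and> G \<noteq> F} + card {G \<in> \<Psi>. (F, G) \<in> P} = n + 2"
    if L: "\<Lambda> \<in> flags P" "F \<in> \<Lambda>" for \<Lambda>
  proof -
    have FF: "(F, F) \<in> P" using L flag_subset refl by blast
    have "{G \<in> \<Lambda>. (G, F) \<in> P} \<union> {G \<in> \<Psi>. (F, G) \<in> P} =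
        {G \<in> \<Lambda>. (G, F) \<in> P \<and> G \<noteq> F} \<union> {G \<in> \<Psi>. (F, G) \<in> P}"
      using F FF by auto
    moreover have "{G \<in> \<Lambda>. (G, F) \<in> P \<and> G \<noteq> F} \<inter> {G \<in> \<Psi>. (F, G) \<in> P} = {}"
      using antisym by auto
    ultimately have "card ({G \<in> \<Lambda>. (G, F) \<in> P} \<union> {G \<in> \<Psi>. (F, G) \<in> P}) =
        card {G \<in> \<Lambda>. (G, F) \<in> P \<and> G \<noteq> F} + card {G \<in> \<Psi>. (F, G) \<in> P}"
      using flag_finite[OF L(1)] flag_finite[OF \<Psi>] by (simp add: card_Un_disjoint)
    then show ?thesis
      using flag_card[OF flag_splice[OF L(1) \<Psi> L(2) F(2)]] by simp
  qed
  show ?thesis using split[OF \<Phi> F(1)] split[OF \<Psi> F(2)] by simp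
qed

lemma face_rank_eq:
  assumes "\<Phi> \<in> flags P" "F \<in> \<Phi>"
  shows "face_rank P F = int (card {G \<in> \<Phi>. (G, F) \<in> P \<and> G \<noteq> F}) - 1"
proof -
  let ?\<Psi> = "SOME \<Psi>. \<Psi> \<in> flags P \<and> F \<in> \<Psi>"
  have "?\<Psi> \<in> flags P \<and> F \<in> ?\<Psi>" using assms by (metis (mono_tags, lifting) someI)
  then show ?thesis
    unfolding face_rank_def using card_below_unique[OF assms(1) _ assms(2), of ?\<Psi>] by simp
qed

lemma rank_less:
  assumes "(F, G) \<in> P" "F \<noteq> G"
  shows "face_rank P F < face_rank P G"
proof -
  obtain \<Phi> where \<Phi>: "\<Phi> \<in> flags P" "F \<in> \<Phi>" "G \<in> \<Phi>" using flag_through[OF assms(1)] .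
  have "{H \<in> \<Phi>. (H, F) \<in> P \<and> H \<noteq> F} \<subset> {H \<in> \<Phi>. (H, G) \<in> P \<and> H \<noteq> G}"
    using assms \<Phi> trans antisym by blast
  then show ?thesis
    using flag_finite[OF \<Phi>(1)] by (simp add: face_rank_eq[OF \<Phi>(1)] \<Phi> psubset_card_mono)
qed

lemma flag_rank_inj: "\<Phi> \<in> flags P \<Longrightarrow> inj_on (face_rank P) \<Phi>"
proof (rule inj_onI)
  fix F G assume "\<Phi> \<in> flags P" "F \<in> \<Phi>" "G \<in> \<Phi>" and eq: "face_rank P F = face_rank P G"
  then have "(F, G) \<in> P \<or> (G, F) \<in> P" by (intro flag_comparable)
  then show "F = G" using rank_less[of F G] rank_less[of G F] eq by force
qed

lemma flag_le_iff:
  assumes "\<Phi> \<in> flags P" "F \<in> \<Phi>" "G \<in> \<Phi>"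
  shows "(F, G) \<in> P \<longleftrightarrow> face_rank P F \<le> face_rank P G"
proof (cases "F = G")
  case True
  then show ?thesis using flag_comparable[OF assms] by simp
next
  case False
  then show ?thesis using rank_less[of F G] rank_less[of G F] flag_comparable[OF assms] by force
qed

text \<open>The ranks lie in an interval with \<open>n + 2\<close> elements, and a flag has
  \<open>n + 2\<close> faces of different ranks, so every value is attained.\<close>

lemma flag_rank_image:
  assumes \<Phi>: "\<Phi> \<in> flags P"
  shows "face_rank P ` \<Phi> = {-1..int n}"
proof -
  have "face_rank P ` \<Phi> \<subseteq> {-1..int n}"
  proof
    fix k assume "k \<in> face_rank P ` \<Phi>"
    then obtain F where F: "F \<in> \<Phi>" "k = face_rank P F" by auto
    have "{G \<in> \<Phi>. (G, F) \<in> P \<and> G \<noteq> F} \<subset> \<Phi>" using F by auto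
    then have "card {G \<in> \<Phi>. (G, F) \<in> P \<and> G \<noteq> F} < card \<Phi>"
      by (rule psubset_card_mono[OF flag_finite[OF \<Phi>]])
    then show "k \<in> {-1..int n}" using F by (simp add: face_rank_eq[OF \<Phi>] flag_card[OF \<Phi>])
  qed
  moreover have "card (face_rank P ` \<Phi>) = card {-1..int n}"
    using flag_rank_inj[OF \<Phi>] flag_card[OF \<Phi>] by (simp add: card_image)
  ultimately show ?thesis by (simp add: card_subset_eq)
qed

text \<open>Reads a flag as a sequence indexed by rank, so that equality and adjacency of flags
  become coordinatewise statements. Only the indices from -1 to \<open>n\<close> are
  meaningful.\<close>

definition face :: "'a set \<Rightarrow> int \<Rightarrow> 'a" where
  "face \<Phi> k = the_inv_into \<Phi> (face_rank P) k"

lemma face_in: "\<lbrakk>\<Phi> \<in> flags P; k \<in> {-1..int n}\<rbrakk> \<Longrightarrow> face \<Phi> k \<in> \<Phi>"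
  and rank_face: "\<lbrakk>\<Phi> \<in> flags P; k \<in> {-1..int n}\<rbrakk> \<Longrightarrow> face_rank P (face \<Phi> k) = k"
  using flag_rank_inj flag_rank_image
  by (auto simp: face_def the_inv_into_into f_the_inv_into_f)

lemma face_rank_face: "\<lbrakk>\<Phi> \<in> flags P; F \<in> \<Phi>\<rbrakk> \<Longrightarrow> face \<Phi> (face_rank P F) = F"
  using flag_rank_inj by (simp add: face_def the_inv_into_f_f)

lemma face_eqI: "\<lbrakk>\<Phi> \<in> flags P; F \<in> \<Phi>; face_rank P F = k\<rbrakk> \<Longrightarrow> face \<Phi> k = F"
  using face_rank_face by blast

lemma rank_range: "\<lbrakk>\<Phi> \<in> flags P; F \<in> \<Phi>\<rbrakk> \<Longrightarrow> face_rank P F \<in> {-1..int n}"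
  using flag_rank_image by blast

lemma flag_eqI:
  assumes "\<Phi> \<in> flags P" "\<Psi> \<in> flags P" "\<And>k. k \<in> {-1..int n} \<Longrightarrow> face \<Phi> k = face \<Psi> k"
  shows "\<Phi> = \<Psi>"
proof -
  have "\<Phi> \<subseteq> \<Psi>"
  proof
    fix F assume "F \<in> \<Phi>"
    then show "F \<in> \<Psi>"
      using face_rank_face[OF assms(1), of F] rank_range[OF assms(1)] assms(3) face_in[OF assms(2)] by metis
  qed
  then show ?thesis using assms by (simp add: card_subset_eq flag_finite flag_card)
qed

section \<open>Adjacency in coordinates and the diamond condition\<close>

lemma adjacent_iff_face:
  "adjacent_flags P i \<Phi> \<Psi> \<longleftrightarrow> \<Phi> \<in> flags P \<and> \<Psi> \<in> flags P \<and> \<Phi> \<noteq> \<Psi> \<and>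
    (\<forall>k \<in> {-1..int n}. k \<noteq> int i \<longrightarrow> face \<Phi> k = face \<Psi> k)"
  (is "_ \<longleftrightarrow> ?R")
proof
  assume adj: "adjacent_flags P i \<Phi> \<Psi>"
  then have f: "\<Phi> \<in> flags P" "\<Psi> \<in> flags P" "\<Phi> \<noteq> \<Psi>"
    and eq: "{F \<in> \<Phi>. face_rank P F \<noteq> int i} = {F \<in> \<Psi>. face_rank P F \<noteq> int i}"
    by (auto simp: adjacent_flags_def)
  have "face \<Phi> k = face \<Psi> k" if k: "k \<in> {-1..int n}" "k \<noteq> int i" for k
  proof -
    have "face \<Phi> k \<in> {F \<in> \<Phi>. face_rank P F \<noteq> int i}"
      using face_in[OF f(1) k(1)] rank_face[OF f(1) k(1)] k(2) by simp
    then have "face \<Phi> k \<in> \<Psi>" using eq by auto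
    then show ?thesis using face_eqI[OF f(2)] rank_face[OF f(1) k(1)] by metis
  qed
  then show ?R using f by blast
next
  assume R: ?R
  have sub: "{F \<in> \<Lambda>. face_rank P F \<noteq> int i} \<subseteq> {F \<in> \<Theta>. face_rank P F \<noteq> int i}"
    if "\<Lambda> \<in> flags P" "\<Theta> \<in> flags P" "\<forall>k \<in> {-1..int n}. k \<noteq> int i \<longrightarrow> face \<Lambda> k = face \<Theta> k" for \<Lambda> \<Theta>
  proof clarify
    fix F assume F: "F \<in> \<Lambda>" "face_rank P F \<noteq> int i"
    then have "face \<Theta> (face_rank P F) = F" "face_rank P F \<in> {-1..int n}"
      using that face_rank_face[OF that(1)] rank_range[OF that(1)] by force+
    then show "F \<in> \<Theta>" using face_in[OF that(2)] by metis
  qed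
  show "adjacent_flags P i \<Phi> \<Psi>"
    unfolding adjacent_flags_def using R sub[of \<Phi> \<Psi>] sub[of \<Psi> \<Phi>] by auto
qed

lemma adjacent_sym: "adjacent_flags P i \<Phi> \<Psi> \<Longrightarrow> adjacent_flags P i \<Psi> \<Phi>"
  by (auto simp: adjacent_flags_def)

lemma adjacent_face_neq:
  assumes "adjacent_flags P i \<Phi> \<Psi>"
  shows "face \<Phi> (int i) \<noteq> face \<Psi> (int i)"
proof
  assume eq: "face \<Phi> (int i) = face \<Psi> (int i)"
  have "\<Phi> = \<Psi>"
  proof (rule flag_eqI)
    show "face \<Phi> k = face \<Psi> k" if "k \<in> {-1..int n}" for k
      using assms eq that unfolding adjacent_iff_face by (cases "k = int i") auto
  qed (use assms in \<open>auto simp: adjacent_flags_def\<close>)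
  then show False using assms by (simp add: adjacent_flags_def)
qed

lemma face_top:
  assumes "\<Phi> \<in> flags P" "\<Psi> \<in> flags P"
  shows "face \<Phi> (int n) = face \<Psi> (int n)"
proof -
  have "\<exists>t \<in> Field P. \<forall>F \<in> Field P. (F, t) \<in> P"
    using abstract_polytope unfolding abstract_polytope_def by (elim conjE)
  then obtain t where t: "t \<in> Field P" "\<And>F. F \<in> Field P \<Longrightarrow> (F, t) \<in> P"
    by blast
  have "face \<Lambda> (int n) = t" if L: "\<Lambda> \<in> flags P" for \<Lambda>
  proof -
    have tL: "t \<in> \<Lambda>"
      by (rule flag_memI[OF L t(1)]) (use t(2) flag_subset[OF L] in blast)
    let ?F = "face \<Lambda> (int n)"
    have F: "?F \<in> \<Lambda>" "face_rank P ?F = int n" using face_in[OF L] rank_face[OF L] by auto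
    then have "(?F, t) \<in> P" using t(2) flag_subset[OF L] by blast
    then have "int n \<le> face_rank P t" using flag_le_iff[OF L F(1) tL] F by simp
    then have "face_rank P t = int n" using rank_range[OF L tL] by simp
    then show ?thesis using face_eqI[OF L tL] by simp
  qed
  then show ?thesis using assms by simp
qed

text \<open>\<open>adjacent_flags\<close> accepts every natural index. Index \<open>n\<close> is
  excluded because all flags share the greatest face, and a larger index because no face has that
  rank.\<close>

lemma adjacent_less: "adjacent_flags P i \<Phi> \<Psi> \<Longrightarrow> i < n"
proof (rule ccontr)
  assume adj: "adjacent_flags P i \<Phi> \<Psi>" and "\<not> i < n"
  then have "n \<le> i" by simp
  have "face \<Phi> k = face \<Psi> k" if "k \<in> {-1..int n}" for k
    using adj that face_top[of \<Phi> \<Psi>] \<open>n \<le> i\<close> unfolding adjacent_iff_face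
    by (cases "k = int i") auto
  then show False using adj flag_eqI[of \<Phi> \<Psi>] by (auto simp: adjacent_flags_def)
qed

definition between :: "'a \<Rightarrow> 'a \<Rightarrow> 'a set" where
  "between F G = {H. (F, H) \<in> P \<and> (H, G) \<in> P \<and> H \<noteq> F \<and> H \<noteq> G}"

lemma between_faces:
  assumes \<Phi>: "\<Phi> \<in> flags P" and i: "i < n"
  shows "face \<Phi> (int i) \<in> between (face \<Phi> (int i - 1)) (face \<Phi> (int i + 1))"
    and "card (between (face \<Phi> (int i - 1)) (face \<Phi> (int i + 1))) = 2"
proof -
  have r: "int i - 1 \<in> {-1..int n}" "int i \<in> {-1..int n}" "int i + 1 \<in> {-1..int n}" using i by auto
  note f = face_in[OF \<Phi> r(1)] face_in[OF \<Phi> r(2)] face_in[OF \<Phi> r(3)]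
  note k = rank_face[OF \<Phi> r(1)] rank_face[OF \<Phi> r(2)] rank_face[OF \<Phi> r(3)]
  have "face \<Phi> (int i) \<noteq> face \<Phi> (int i - 1)" "face \<Phi> (int i) \<noteq> face \<Phi> (int i + 1)"
    using k by (metis add_cancel_right_right diff_add_cancel zero_neq_one)+
  then show "face \<Phi> (int i) \<in> between (face \<Phi> (int i - 1)) (face \<Phi> (int i + 1))"
    using flag_le_iff[OF \<Phi> f(1) f(2)] flag_le_iff[OF \<Phi> f(2) f(3)] k by (simp add: between_def)
  have "(face \<Phi> (int i - 1), face \<Phi> (int i + 1)) \<in> P"
    using flag_le_iff[OF \<Phi> f(1) f(3)] k by simp
  then show "card (between (face \<Phi> (int i - 1)) (face \<Phi> (int i + 1))) = 2"
    unfolding between_def using k by (intro diamond) auto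
qed

lemma ex_adjacent:
  assumes \<Phi>: "\<Phi> \<in> flags P" and i: "i < n"
  shows "\<exists>\<Psi>. adjacent_flags P i \<Phi> \<Psi>"
proof -
  let ?F = "face \<Phi> (int i - 1)" and ?G = "face \<Phi> (int i + 1)" and ?H = "face \<Phi> (int i)"
  have r: "int i - 1 \<in> {-1..int n}" "int i \<in> {-1..int n}" "int i + 1 \<in> {-1..int n}" using i by auto
  note f = face_in[OF \<Phi> r(1)] face_in[OF \<Phi> r(2)] face_in[OF \<Phi> r(3)]
  note k = rank_face[OF \<Phi> r(1)] rank_face[OF \<Phi> r(2)] rank_face[OF \<Phi> r(3)]
  \<comment> \<open>The diamond has two middle faces; \<open>H'\<close> is the one not in \<Phi>,
    and exchanging it for \<open>?H\<close> gives the adjacent flag.\<close>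
  obtain H' where H': "H' \<in> between ?F ?G" "H' \<noteq> ?H"
    using between_faces[OF assms] by (metis card_2_iff' )
  then have P': "(?F, H') \<in> P" "(H', ?G) \<in> P" "H' \<noteq> ?F" "H' \<noteq> ?G" by (auto simp: between_def)
  have rH': "face_rank P H' = int i"
    using rank_less[OF P'(1)] rank_less[OF P'(2)] P' k by auto
  have H'\<Phi>: "H' \<notin> \<Phi>" using H' rH' face_eqI[OF \<Phi>, of H'] by auto
  let ?\<Psi> = "insert H' (\<Phi> - {?H})"
  have comp: "(Z, H') \<in> P \<or> (H', Z) \<in> P" if Z: "Z \<in> \<Phi> - {?H}" for Z
  proof -
    have "face_rank P Z \<noteq> int i" using Z face_eqI[OF \<Phi>, of Z] by auto
    \<comment> \<open>Every face of \<Phi> other than \<open>?H\<close> lies weakly below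
      \<open>?F\<close> or weakly above \<open>?G\<close>, so it is comparable to \<open>H'\<close>
      by transitivity.\<close>
    then consider "face_rank P Z \<le> int i - 1" | "int i + 1 \<le> face_rank P Z" by linarith
    then show ?thesis
    proof cases
      case 1
      then have "(Z, ?F) \<in> P" using Z flag_le_iff[OF \<Phi> _ f(1), of Z] k by simp
      then show ?thesis using P' trans by blast
    next
      case 2
      then have "(?G, Z) \<in> P" using Z flag_le_iff[OF \<Phi> f(3), of Z] k by simp
      then show ?thesis using P' trans by blast
    qed
  qed
  have "?\<Psi> \<in> Chains P"
    using comp flag_comparable[OF \<Phi>] refl in_Field(2)[OF P'(1)] by (auto simp: Chains_def)
  moreover have "card ?\<Psi> = n + 2"
    using H'\<Phi> f(2) flag_card[OF \<Phi>] flag_finite[OF \<Phi>] by simp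
  ultimately have \<Psi>: "?\<Psi> \<in> flags P" by (rule chain_flagI)
  have "{F \<in> \<Phi>. face_rank P F \<noteq> int i} = {F \<in> ?\<Psi>. face_rank P F \<noteq> int i}"
    using rH' k by auto
  then have "adjacent_flags P i \<Phi> ?\<Psi>"
    using \<Phi> \<Psi> H'\<Phi> by (auto simp: adjacent_flags_def)
  then show ?thesis by blast
qed

text \<open>The new face of rank \<open>i\<close> is the other middle face of the diamond, hence
  determined by the old faces of ranks \<open>i - 1\<close>, \<open>i\<close> and
  \<open>i + 1\<close>. This locality yields both uniqueness of the adjacent flag and commutation of
  distant exchanges.\<close>

lemma adjacent_face_cong:
  assumes "adjacent_flags P i \<Phi> \<Phi>'" "adjacent_flags P i \<Psi> \<Psi>'"
    and "\<And>k. k \<in> {int i - 1, int i, int i + 1} \<Longrightarrow> face \<Phi> k = face \<Psi> k"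
  shows "face \<Phi>' (int i) = face \<Psi>' (int i)"
proof -
  have i: "i < n" using assms(1) by (rule adjacent_less)
  let ?B = "between (face \<Phi> (int i - 1)) (face \<Phi> (int i + 1))"
  have f: "\<Phi> \<in> flags P" "\<Psi> \<in> flags P" "\<Phi>' \<in> flags P" "\<Psi>' \<in> flags P"
    using assms by (auto simp: adjacent_flags_def)
  have r: "int i - 1 \<in> {-1..int n}" "int i \<in> {-1..int n}" "int i + 1 \<in> {-1..int n}" using i by auto
  have "face \<Phi>' (int i - 1) = face \<Phi> (int i - 1)" "face \<Phi>' (int i + 1) = face \<Phi> (int i + 1)"
    "face \<Psi>' (int i - 1) = face \<Psi> (int i - 1)" "face \<Psi>' (int i + 1) = face \<Psi> (int i + 1)"
    using assms(1,2) r unfolding adjacent_iff_face by auto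
  then have "face \<Phi>' (int i) \<in> ?B" "face \<Psi>' (int i) \<in> ?B"
    using between_faces(1)[OF f(3) i] between_faces(1)[OF f(4) i] assms(3) by auto
  moreover have "face \<Phi> (int i) \<in> ?B" "card ?B = 2" using between_faces[OF f(1) i] .
  moreover have "face \<Phi>' (int i) \<noteq> face \<Phi> (int i)" "face \<Psi>' (int i) \<noteq> face \<Phi> (int i)"
    using adjacent_face_neq[OF assms(1)] adjacent_face_neq[OF assms(2)] assms(3)[of "int i"] by auto
  ultimately show ?thesis by (metis card_2_iff')
qed

lemma adjacent_unique:
  assumes "adjacent_flags P i \<Phi> \<Psi>" "adjacent_flags P i \<Phi> \<Psi>'"
  shows "\<Psi> = \<Psi>'"
proof (rule flag_eqI)
  show "face \<Psi> k = face \<Psi>' k" if "k \<in> {-1..int n}" for k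
    using assms adjacent_face_cong[OF assms] that unfolding adjacent_iff_face
    by (cases "k = int i") auto
qed (use assms in \<open>auto simp: adjacent_flags_def\<close>)

section \<open>The exchange maps on flags and induction along flag paths\<close>

lemma adj_eqI: "adjacent_flags P i \<Phi> \<Psi> \<Longrightarrow> adj P i \<Phi> = \<Psi>"
  unfolding adj_def by (rule the_equality, assumption, rule adjacent_unique)

lemma adjacent_adj: "\<lbrakk>\<Phi> \<in> flags P; i < n\<rbrakk> \<Longrightarrow> adjacent_flags P i \<Phi> (adj P i \<Phi>)"
  using ex_adjacent adj_eqI by metis

lemma adj_flag: "\<lbrakk>\<Phi> \<in> flags P; i < n\<rbrakk> \<Longrightarrow> adj P i \<Phi> \<in> flags P"
  using adjacent_adj by (auto simp: adjacent_flags_def)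

lemma adj_adj: "\<lbrakk>\<Phi> \<in> flags P; i < n\<rbrakk> \<Longrightarrow> adj P i (adj P i \<Phi>) = \<Phi>"
  using adjacent_adj adjacent_sym adj_eqI by metis

lemma face_adj:
  "\<lbrakk>\<Phi> \<in> flags P; i < n; k \<in> {-1..int n}; k \<noteq> int i\<rbrakk> \<Longrightarrow> face (adj P i \<Phi>) k = face \<Phi> k"
  using adjacent_adj[of \<Phi> i] unfolding adjacent_iff_face by simp

text \<open>Exchanging the face of rank \<open>j\<close> leaves the faces of ranks
  \<open>i - 1\<close>, \<open>i\<close>, \<open>i + 1\<close> alone, so the exchange at
  \<open>i\<close> finds the same diamond before and after it; and symmetrically.\<close>

lemma adj_commute:
  assumes \<Phi>: "\<Phi> \<in> flags P" and "i < n" "j < n" "i + 2 \<le> j"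
  shows "adj P i (adj P j \<Phi>) = adj P j (adj P i \<Phi>)"
proof (rule flag_eqI)
  fix k assume k: "k \<in> {-1..int n}"
  note fl = \<Phi> adj_flag[OF \<Phi> \<open>i < n\<close>] adj_flag[OF \<Phi> \<open>j < n\<close>]
  have i: "face (adj P i (adj P j \<Phi>)) (int i) = face (adj P i \<Phi>) (int i)"
    by (rule adjacent_face_cong[of _ "adj P j \<Phi>" _ \<Phi>])
      (use assms fl in \<open>auto intro!: adjacent_adj face_adj\<close>)
  have j: "face (adj P j (adj P i \<Phi>)) (int j) = face (adj P j \<Phi>) (int j)"
    by (rule adjacent_face_cong[of _ "adj P i \<Phi>" _ \<Phi>])
      (use assms fl in \<open>auto intro!: adjacent_adj face_adj\<close>)
  show "face (adj P i (adj P j \<Phi>)) k = face (adj P j (adj P i \<Phi>)) k"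
    using i j \<open>i + 2 \<le> j\<close>
      face_adj[OF fl(1) \<open>i < n\<close> k] face_adj[OF fl(1) \<open>j < n\<close> k]
      face_adj[OF fl(2) \<open>j < n\<close> k] face_adj[OF fl(3) \<open>i < n\<close> k]
    by (cases "k = int i"; cases "k = int j") simp_all
qed (use assms in \<open>auto intro!: adj_flag\<close>)

text \<open>An induction principle along a path on which every flag keeps all faces common to the
  two ends. Properties attached to one common face can thus be transported.\<close>

lemma strongly_connected:
  assumes "\<Phi> \<in> flags P" "\<Psi> \<in> flags P" and "Q \<Phi>"
    and "\<And>\<Gamma> i. \<lbrakk>\<Gamma> \<in> flags P; i < n; \<Phi> \<inter> \<Psi> \<subseteq> \<Gamma>; \<Phi> \<inter> \<Psi> \<subseteq> adj P i \<Gamma>; Q \<Gamma>\<rbrakk> \<Longrightarrow> Q (adj P i \<Gamma>)"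
  shows "Q \<Psi>"
proof -
  have "(\<Phi>, \<Psi>) \<in> {(\<Gamma>, \<Delta>). \<Phi> \<inter> \<Psi> \<subseteq> \<Gamma> \<and> \<Phi> \<inter> \<Psi> \<subseteq> \<Delta> \<and> (\<exists>i. adjacent_flags P i \<Gamma> \<Delta>)}\<^sup>*"
    using abstract_polytope assms(1,2) by (auto simp: abstract_polytope_def strongly_flag_connected_def)
  then show ?thesis
  proof (induction rule: rtrancl_induct)
    case (step \<Gamma> \<Delta>)
    then obtain i where i: "adjacent_flags P i \<Gamma> \<Delta>" "\<Phi> \<inter> \<Psi> \<subseteq> \<Gamma>" "\<Phi> \<inter> \<Psi> \<subseteq> \<Delta>" by auto
    then have "adj P i \<Gamma> = \<Delta>" "\<Gamma> \<in> flags P" "i < n"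
      using adj_eqI adjacent_less by (auto simp: adjacent_flags_def)
    then show ?case using assms(4)[of \<Gamma> i] i step by simp
  qed (rule assms(3))
qed

lemma flag_induct:
  assumes "\<Phi> \<in> flags P" "\<Psi> \<in> flags P" "Q \<Phi>"
    and "\<And>\<Gamma> i. \<lbrakk>\<Gamma> \<in> flags P; i < n; Q \<Gamma>\<rbrakk> \<Longrightarrow> Q (adj P i \<Gamma>)"
  shows "Q \<Psi>"
  using assms strongly_connected[of \<Phi> \<Psi> Q] by blast

section \<open>Automorphisms\<close>

lemma aut_iff:
  "f \<in> carrier (aut_group P) \<longleftrightarrow> f \<in> Bij (Field P) \<and>
    (\<forall>x \<in> Field P. \<forall>y \<in> Field P. (f x, f y) \<in> P \<longleftrightarrow> (x, y) \<in> P)"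
  by (simp add: aut_group_def)

lemma aut_mult: "f \<otimes>\<^bsub>aut_group P\<^esub> g = compose (Field P) g f"
  by (simp add: aut_group_def)

lemma aut_one: "\<one>\<^bsub>aut_group P\<^esub> = (\<lambda>x \<in> Field P. x)"
  by (simp add: aut_group_def)

lemma aut_closed: "\<lbrakk>f \<in> carrier (aut_group P); x \<in> Field P\<rbrakk> \<Longrightarrow> f x \<in> Field P"
  unfolding aut_iff using Bij_imp_funcset by blast

lemma group_aut: "group (aut_group P)"
proof (rule groupI)
  fix f g assume fg: "f \<in> carrier (aut_group P)" "g \<in> carrier (aut_group P)"
  then show "f \<otimes>\<^bsub>aut_group P\<^esub> g \<in> carrier (aut_group P)"
    using aut_closed[OF fg(1)] by (auto simp: aut_iff aut_mult compose_Bij compose_eq)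
  fix h assume h: "h \<in> carrier (aut_group P)"
  show "f \<otimes>\<^bsub>aut_group P\<^esub> g \<otimes>\<^bsub>aut_group P\<^esub> h = f \<otimes>\<^bsub>aut_group P\<^esub> (g \<otimes>\<^bsub>aut_group P\<^esub> h)"
    using aut_closed[OF fg(1)] by (auto simp: aut_mult compose_def)
next
  show "\<one>\<^bsub>aut_group P\<^esub> \<in> carrier (aut_group P)"
    by (auto simp: aut_iff aut_one id_Bij)
next
  fix f assume f: "f \<in> carrier (aut_group P)"
  then have B: "f \<in> Bij (Field P)" by (simp add: aut_iff)
  then show "\<one>\<^bsub>aut_group P\<^esub> \<otimes>\<^bsub>aut_group P\<^esub> f = f"
    by (auto simp: aut_mult aut_one compose_def Bij_def extensional_def)
  let ?g = "\<lambda>x \<in> Field P. inv_into (Field P) f x"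
  have bij: "bij_betw f (Field P) (Field P)" using B by (simp add: Bij_def)
  have fg: "f (?g x) = x" "?g x \<in> Field P" if "x \<in> Field P" for x
    using that bij bij_betw_inv_into_right[OF bij that] Bij_inv_into_mem[OF B that] by auto
  have "(?g x, ?g y) \<in> P \<longleftrightarrow> (x, y) \<in> P" if "x \<in> Field P" "y \<in> Field P" for x y
    using f fg(1)[OF that(1)] fg(1)[OF that(2)] fg(2)[OF that(1)] fg(2)[OF that(2)]
    unfolding aut_iff by metis
  then have "?g \<in> carrier (aut_group P)"
    using restrict_inv_into_Bij[OF B] by (simp add: aut_iff)
  moreover have "?g \<otimes>\<^bsub>aut_group P\<^esub> f = \<one>\<^bsub>aut_group P\<^esub>"
    unfolding aut_mult aut_one compose_def using fg(1) by (rule restrict_ext)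
  ultimately show "\<exists>g\<in>carrier (aut_group P). g \<otimes>\<^bsub>aut_group P\<^esub> f = \<one>\<^bsub>aut_group P\<^esub>" by blast
qed

sublocale aut: group "aut_group P"
  by (rule group_aut)

lemma aut_le_iff:
  "\<lbrakk>f \<in> carrier (aut_group P); x \<in> Field P; y \<in> Field P\<rbrakk> \<Longrightarrow> (f x, f y) \<in> P \<longleftrightarrow> (x, y) \<in> P"
  by (simp add: aut_iff)

lemma aut_inj: "f \<in> carrier (aut_group P) \<Longrightarrow> inj_on f (Field P)"
  by (simp add: aut_iff Bij_def bij_betw_def)

lemma image_mult:
  assumes "\<Phi> \<in> flags P"
  shows "(f \<otimes>\<^bsub>aut_group P\<^esub> g) ` \<Phi> = g ` f ` \<Phi>"
proof -
  have "(f \<otimes>\<^bsub>aut_group P\<^esub> g) ` \<Phi> = (g \<circ> f) ` \<Phi>"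
    by (rule image_cong) (use flag_subset[OF assms] in \<open>auto simp: aut_mult compose_def\<close>)
  then show ?thesis by (simp add: image_comp)
qed

lemma image_one:
  assumes "\<Phi> \<in> flags P"
  shows "\<one>\<^bsub>aut_group P\<^esub> ` \<Phi> = \<Phi>"
  using flag_subset[OF assms] by (force simp: aut_one)

section \<open>The action of automorphisms on flags\<close>

lemma aut_flag:
  assumes "f \<in> carrier (aut_group P)" "\<Phi> \<in> flags P"
  shows "f ` \<Phi> \<in> flags P"
proof (rule chain_flagI)
  show "f ` \<Phi> \<in> Chains P"
    using flag_comparable[OF assms(2)] flag_subset[OF assms(2)] aut_le_iff[OF assms(1)]
    unfolding Chains_def by blast
  show "card (f ` \<Phi>) = n + 2"
    using flag_card[OF assms(2)] inj_on_subset[OF aut_inj[OF assms(1)] flag_subset[OF assms(2)]]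
    by (simp add: card_image)
qed

lemma aut_rank:
  assumes f: "f \<in> carrier (aut_group P)" and "F \<in> Field P"
  shows "face_rank P (f F) = face_rank P F"
proof -
  obtain \<Phi> where \<Phi>: "\<Phi> \<in> flags P" "F \<in> \<Phi>" using flag_through[OF refl[OF assms(2)]] .
  have sub: "\<Phi> \<subseteq> Field P" using \<Phi> flag_subset by blast
  have "(f G, f F) \<in> P \<longleftrightarrow> (G, F) \<in> P" "f G = f F \<longleftrightarrow> G = F" if "G \<in> \<Phi>" for G
  proof -
    have "G \<in> Field P" using that sub by blast
    then show "(f G, f F) \<in> P \<longleftrightarrow> (G, F) \<in> P" "f G = f F \<longleftrightarrow> G = F"
      using aut_le_iff[OF f _ assms(2)] inj_on_eq_iff[OF aut_inj[OF f] _ assms(2)] by blast+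
  qed
  then have "{G \<in> f ` \<Phi>. (G, f F) \<in> P \<and> G \<noteq> f F} = f ` {G \<in> \<Phi>. (G, F) \<in> P \<and> G \<noteq> F}"
    by auto
  moreover have "inj_on f {G \<in> \<Phi>. (G, F) \<in> P \<and> G \<noteq> F}"
    using sub by (auto intro: inj_on_subset[OF aut_inj[OF f]])
  ultimately show ?thesis
    using face_rank_eq[OF aut_flag[OF f \<Phi>(1)], of "f F"] face_rank_eq[OF \<Phi>] \<Phi>(2)
    by (simp add: card_image)
qed

lemma aut_face:
  assumes "f \<in> carrier (aut_group P)" "\<Phi> \<in> flags P" "k \<in> {-1..int n}"
  shows "face (f ` \<Phi>) k = f (face \<Phi> k)"
  using assms face_in[OF assms(2,3)] flag_subset[OF assms(2)]
  by (intro face_eqI) (auto simp: aut_flag aut_rank rank_face subset_iff)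

text \<open>Automorphisms preserve rank, so they act coordinatewise on flags and keep adjacency. All
  later flag computations rest on this commutation of the group action with the exchange
  maps.\<close>

lemma aut_adj:
  assumes f: "f \<in> carrier (aut_group P)" and \<Phi>: "\<Phi> \<in> flags P" and i: "i < n"
  shows "adj P i (f ` \<Phi>) = f ` adj P i \<Phi>"
proof (rule adj_eqI)
  note adj = adjacent_adj[OF \<Phi> i]
  have "face \<Phi> (int i) \<noteq> face (adj P i \<Phi>) (int i)" by (rule adjacent_face_neq[OF adj])
  moreover have "face \<Phi> (int i) \<in> Field P" "face (adj P i \<Phi>) (int i) \<in> Field P"
    using face_in[of _ "int i"] flag_subset \<Phi> i adj_flag[OF \<Phi> i] by auto
  ultimately have "f (face \<Phi> (int i)) \<noteq> f (face (adj P i \<Phi>) (int i))"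
    using aut_inj[OF f] by (auto dest: inj_onD)
  then have "f ` \<Phi> \<noteq> f ` adj P i \<Phi>"
    using aut_face[OF f \<Phi>, of "int i"] aut_face[OF f adj_flag[OF \<Phi> i], of "int i"] i by auto
  then show "adjacent_flags P i (f ` \<Phi>) (f ` adj P i \<Phi>)"
    using adj f unfolding adjacent_iff_face by (auto simp: aut_flag aut_face)
qed

text \<open>The fixed flags are closed under exchanges, so connectivity makes every flag fixed. Each
  face is the only one of its rank in a flag through it, hence fixed too.\<close>

lemma aut_fixes_flag:
  assumes f: "f \<in> carrier (aut_group P)" and \<Phi>: "\<Phi> \<in> flags P" and "f ` \<Phi> = \<Phi>"
  shows "f = \<one>\<^bsub>aut_group P\<^esub>"
proof -
  have all: "f ` \<Psi> = \<Psi>" if "\<Psi> \<in> flags P" for \<Psi>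
    using \<Phi> that assms(3) by (rule flag_induct) (use aut_adj[OF f] in metis)
  have "f x = x" if x: "x \<in> Field P" for x
  proof -
    obtain \<Psi> where \<Psi>: "\<Psi> \<in> flags P" "x \<in> \<Psi>" using flag_through[OF refl[OF x]] .
    then have "f x \<in> \<Psi>" using all by blast
    then have "face \<Psi> (face_rank P x) = f x" using face_eqI[OF \<Psi>(1)] aut_rank[OF f x] by simp
    then show ?thesis using face_rank_face[OF \<Psi>] by simp
  qed
  then show ?thesis
    using f by (auto simp: aut_one aut_iff Bij_def extensional_def)
qed

lemma aut_determined:
  assumes "f \<in> carrier (aut_group P)" "g \<in> carrier (aut_group P)" "\<Phi> \<in> flags P" "f ` \<Phi> = g ` \<Phi>"
  shows "f = g"
proof -
  have "(f \<otimes>\<^bsub>aut_group P\<^esub> inv\<^bsub>aut_group P\<^esub> g) ` \<Phi> = (g \<otimes>\<^bsub>aut_group P\<^esub> inv\<^bsub>aut_group P\<^esub> g) ` \<Phi>"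
    using assms by (simp only: image_mult)
  then have "(f \<otimes>\<^bsub>aut_group P\<^esub> inv\<^bsub>aut_group P\<^esub> g) ` \<Phi> = \<Phi>"
    using assms by (simp add: image_one)
  then have "f \<otimes>\<^bsub>aut_group P\<^esub> inv\<^bsub>aut_group P\<^esub> g = \<one>\<^bsub>aut_group P\<^esub>"
    using assms by (intro aut_fixes_flag) auto
  then show ?thesis
    using assms by (metis aut.inv_equality aut.inv_closed aut.inv_inv)
qed

text \<open>Well-definedness on faces is where strong (rather than mere) flag-connectedness enters.\<close>

lemma aut_of_flag_involution:
  assumes \<tau>: "\<And>\<Psi>. \<Psi> \<in> flags P \<Longrightarrow> \<tau> \<Psi> \<in> flags P"
    and inv: "\<And>\<Psi>. \<Psi> \<in> flags P \<Longrightarrow> \<tau> (\<tau> \<Psi>) = \<Psi>"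
    and adj: "\<And>\<Psi> i. \<lbrakk>\<Psi> \<in> flags P; i < n\<rbrakk> \<Longrightarrow> \<tau> (adj P i \<Psi>) = adj P i (\<tau> \<Psi>)"
  obtains f where "f \<in> carrier (aut_group P)" "\<And>\<Psi>. \<Psi> \<in> flags P \<Longrightarrow> f ` \<Psi> = \<tau> \<Psi>"
proof -
  define f where "f = (\<lambda>x \<in> Field P. face (\<tau> (SOME \<Psi>. \<Psi> \<in> flags P \<and> x \<in> \<Psi>)) (face_rank P x))"
  have indep: "face (\<tau> \<Psi>) (face_rank P x) = face (\<tau> \<Psi>') (face_rank P x)"
    if \<Psi>: "\<Psi> \<in> flags P" "x \<in> \<Psi>" and \<Psi>': "\<Psi>' \<in> flags P" "x \<in> \<Psi>'" for x \<Psi> \<Psi>'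
  proof (rule strongly_connected[OF \<Psi>(1) \<Psi>'(1)])
    fix \<Gamma> i
    assume \<Gamma>: "\<Gamma> \<in> flags P" "i < n" "\<Psi> \<inter> \<Psi>' \<subseteq> \<Gamma>" "\<Psi> \<inter> \<Psi>' \<subseteq> adj P i \<Gamma>"
      and eq: "face (\<tau> \<Psi>) (face_rank P x) = face (\<tau> \<Gamma>) (face_rank P x)"
    have x: "x \<in> \<Gamma>" "x \<in> adj P i \<Gamma>" using \<Gamma> \<Psi> \<Psi>' by auto
    \<comment> \<open>Both flags of the step contain \<open>x\<close>, whereas their faces of rank
      \<open>i\<close> differ. The exchange therefore leaves the coordinate at the rank of
      \<open>x\<close> unchanged.\<close>
    have "face_rank P x \<noteq> int i"
      using adjacent_face_neq[OF adjacent_adj[OF \<Gamma>(1,2)]] face_rank_face[OF \<Gamma>(1) x(1)]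
        face_rank_face[OF adj_flag[OF \<Gamma>(1,2)] x(2)] by metis
    then show "face (\<tau> \<Psi>) (face_rank P x) = face (\<tau> (adj P i \<Gamma>)) (face_rank P x)"
      using eq face_adj[OF \<tau>[OF \<Gamma>(1)] \<Gamma>(2) rank_range[OF \<Gamma>(1) x(1)]] adj[OF \<Gamma>(1,2)] by simp
  qed (rule HOL.refl)
  have f_eq: "f x = face (\<tau> \<Psi>) (face_rank P x)" if \<Psi>: "\<Psi> \<in> flags P" "x \<in> \<Psi>" for x \<Psi>
  proof -
    let ?\<Psi> = "SOME \<Psi>. \<Psi> \<in> flags P \<and> x \<in> \<Psi>"
    have "?\<Psi> \<in> flags P \<and> x \<in> ?\<Psi>" using that by (metis (mono_tags, lifting) someI)
    then show ?thesis using indep[of ?\<Psi> x \<Psi>] that flag_subset[OF \<Psi>(1)] by (auto simp: f_def)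
  qed
  have f_in: "f x \<in> \<tau> \<Psi>" "face_rank P (f x) = face_rank P x" if \<Psi>: "\<Psi> \<in> flags P" "x \<in> \<Psi>" for x \<Psi>
    using f_eq[OF that] face_in[OF \<tau>[OF \<Psi>(1)] rank_range[OF that]]
      rank_face[OF \<tau>[OF \<Psi>(1)] rank_range[OF that]] by auto
  have ff: "f (f x) = x" "f x \<in> Field P" if x: "x \<in> Field P" for x
  proof -
    obtain \<Psi> where \<Psi>: "\<Psi> \<in> flags P" "x \<in> \<Psi>" using flag_through[OF refl[OF x]] .
    show "f (f x) = x"
      using f_eq[OF \<tau>[OF \<Psi>(1)] f_in(1)[OF \<Psi>]] inv[OF \<Psi>(1)] f_in(2)[OF \<Psi>] face_rank_face[OF \<Psi>] by simp
    show "f x \<in> Field P" using f_in(1)[OF \<Psi>] flag_subset[OF \<tau>[OF \<Psi>(1)]] by blast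
  qed
  have mono: "(f x, f y) \<in> P" if xy: "(x, y) \<in> P" for x y
  proof -
    obtain \<Psi> where \<Psi>: "\<Psi> \<in> flags P" "x \<in> \<Psi>" "y \<in> \<Psi>" using flag_through[OF xy] .
    then show ?thesis
      using flag_le_iff[OF \<tau>[OF \<Psi>(1)] f_in(1)[OF \<Psi>(1,2)] f_in(1)[OF \<Psi>(1,3)]]
        flag_le_iff[OF \<Psi>] f_in(2) xy by metis
  qed
  \<comment> \<open>Since \<tau> is an involution, \<open>f\<close> is its own inverse; this gives
    bijectivity here and reflection of the order below.\<close>
  have "bij_betw f (Field P) (Field P)"
    by (rule bij_betw_byWitness[of _ f]) (use ff in auto)
  moreover have "f \<in> extensional (Field P)" by (simp add: f_def)
  moreover have "(f x, f y) \<in> P \<longleftrightarrow> (x, y) \<in> P" if "x \<in> Field P" "y \<in> Field P" for x y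
    using mono mono[of "f x" "f y"] ff that by metis
  ultimately have aut: "f \<in> carrier (aut_group P)" by (simp add: aut_iff Bij_def)
  have "f ` \<Psi> = \<tau> \<Psi>" if "\<Psi> \<in> flags P" for \<Psi>
  proof (rule card_subset_eq)
    show "card (f ` \<Psi>) = card (\<tau> \<Psi>)" using that \<tau> aut_flag[OF aut] flag_card by simp
  qed (use that f_in \<tau> flag_finite in auto)
  then show ?thesis using that aut by blast
qed

end

section \<open>Groups given by generators and relators\<close>

lemma word_eq_words:
  assumes "word_eq S R u v"
  shows "u \<in> lists (S \<times> UNIV)" "v \<in> lists (S \<times> UNIV)"
  using assms by (induction) auto

lemma word_eq_context:
  assumes "word_eq S R u v" "x \<in> lists (S \<times> UNIV)" "y \<in> lists (S \<times> UNIV)"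
  shows "word_eq S R (x @ u @ y) (x @ v @ y)"
  using assms
proof (induction)
  case (refl u)
  then show ?case by (intro word_eq.refl) auto
next
  case (cancel u v s b)
  then show ?case
    using word_eq.cancel[of "x @ u" S "v @ y" s R b] by simp
next
  case (relator u v r)
  then show ?case
    using word_eq.relator[of "x @ u" S "v @ y" r R] by simp
qed (auto intro: word_eq.sym word_eq.trans)

lemma word_eq_append:
  assumes "word_eq S R u u'" "word_eq S R v v'"
  shows "word_eq S R (u @ v) (u' @ v')"
proof -
  have "word_eq S R (u @ v) (u' @ v)"
    using word_eq_context[OF assms(1), of "[]" v] word_eq_words[OF assms(2)] by simp
  moreover have "word_eq S R (u' @ v) (u' @ v')"
    using word_eq_context[OF assms(2), of u' "[]"] word_eq_words[OF assms(1)] by simp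
  ultimately show ?thesis by (rule word_eq.trans)
qed

definition word_class :: "'s set \<Rightarrow> ('s \<times> bool) list set \<Rightarrow> ('s \<times> bool) list \<Rightarrow> ('s \<times> bool) list set" where
  "word_class S R u = {v. word_eq S R u v}"

lemma word_class_eq_iff:
  assumes "u \<in> lists (S \<times> UNIV)"
  shows "word_class S R u = word_class S R v \<longleftrightarrow> word_eq S R u v"
  unfolding word_class_def using assms
  by (auto intro: word_eq.refl word_eq.sym word_eq.trans)

lemma carrier_presented_group:
  "carrier (presented_group S R) = word_class S R ` lists (S \<times> UNIV)"
  by (auto simp: presented_group_def quotient_def word_class_def Image_def)

lemma one_presented_group: "\<one>\<^bsub>presented_group S R\<^esub> = word_class S R []"
  by (simp add: presented_group_def word_class_def)

lemma mult_presented_group: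
  assumes "u \<in> lists (S \<times> UNIV)" "v \<in> lists (S \<times> UNIV)"
  shows "word_class S R u \<otimes>\<^bsub>presented_group S R\<^esub> word_class S R v = word_class S R (u @ v)"
proof -
  have "word_eq S R u u" "word_eq S R v v"
    using assms by (auto intro: word_eq.refl)
  then show ?thesis
    by (auto simp: presented_group_def word_class_def intro: word_eq.trans word_eq_append)
qed

definition word_inv :: "('s \<times> bool) list \<Rightarrow> ('s \<times> bool) list" where
  "word_inv w = rev (map (\<lambda>(s, b). (s, \<not> b)) w)"

lemma word_inv_words: "w \<in> lists (S \<times> UNIV) \<Longrightarrow> word_inv w \<in> lists (S \<times> UNIV)"
  by (auto simp: word_inv_def in_lists_conv_set)

lemma word_inv_eq:
  assumes "w \<in> lists (S \<times> UNIV)"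
  shows "word_eq S R (word_inv w @ w) []"
  using assms
proof (induction w)
  case Nil
  then show ?case by (simp add: word_inv_def word_eq.refl)
next
  case (Cons a w)
  obtain s b where a: "a = (s, b)" by force
  \<comment> \<open>The inverse of the first letter ends \<open>word_inv (a # w)\<close>, so the
    cancellation happens in the middle. The double negation fits the shape of the rule
    \<open>cancel\<close>.\<close>
  have "word_eq S R (word_inv w @ [(s, \<not> b), (s, \<not> \<not> b)] @ w) (word_inv w @ w)"
    using Cons a by (intro word_eq.cancel word_inv_words) auto
  then show ?case
    using Cons a by (auto simp: word_inv_def intro: word_eq.trans)
qed

lemma group_presented_group: "group (presented_group S R)" (is "group ?P")
proof (rule groupI)
  fix x y assume "x \<in> carrier ?P" "y \<in> carrier ?P"
  then obtain u v where uv: "u \<in> lists (S \<times> UNIV)" "v \<in> lists (S \<times> UNIV)"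
    "x = word_class S R u" "y = word_class S R v"
    unfolding carrier_presented_group by blast
  then show "x \<otimes>\<^bsub>?P\<^esub> y \<in> carrier ?P"
    using append_in_lists_conv[of u v "S \<times> UNIV"]
    by (simp add: carrier_presented_group mult_presented_group)
  fix z assume "z \<in> carrier ?P"
  then obtain w where w: "w \<in> lists (S \<times> UNIV)" "z = word_class S R w"
    unfolding carrier_presented_group by blast
  with uv show "x \<otimes>\<^bsub>?P\<^esub> y \<otimes>\<^bsub>?P\<^esub> z = x \<otimes>\<^bsub>?P\<^esub> (y \<otimes>\<^bsub>?P\<^esub> z)"
    using append_in_lists_conv[of u v "S \<times> UNIV"] append_in_lists_conv[of v w "S \<times> UNIV"]
    by (simp add: mult_presented_group)
next
  fix x assume "x \<in> carrier ?P"
  then obtain w where w: "w \<in> lists (S \<times> UNIV)" "x = word_class S R w"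
    unfolding carrier_presented_group by blast
  then show "\<one>\<^bsub>?P\<^esub> \<otimes>\<^bsub>?P\<^esub> x = x"
    by (simp add: one_presented_group mult_presented_group)
  have inv: "word_inv w \<in> lists (S \<times> UNIV)" using w by (simp add: word_inv_words)
  have "word_class S R (word_inv w) \<otimes>\<^bsub>?P\<^esub> x = word_class S R (word_inv w @ w)"
    using w inv by (simp add: mult_presented_group)
  also have "\<dots> = \<one>\<^bsub>?P\<^esub>"
    using w inv word_inv_eq[OF w(1)] append_in_lists_conv[of "word_inv w" w "S \<times> UNIV"]
    by (simp add: one_presented_group word_class_eq_iff)
  finally show "\<exists>y\<in>carrier ?P. y \<otimes>\<^bsub>?P\<^esub> x = \<one>\<^bsub>?P\<^esub>"
    using inv unfolding carrier_presented_group by blast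
qed (simp add: carrier_presented_group one_presented_group)

section \<open>Evaluation of words and homomorphisms out of a presented group\<close>

lemma (in group) word_val_closed:
  assumes "\<And>s. s \<in> S \<Longrightarrow> f s \<in> carrier G" "w \<in> lists (S \<times> UNIV)"
  shows "word_val G f w \<in> carrier G"
  using assms(2) by (induction w) (auto simp: word_val_def assms(1))

lemma word_val_Nil [simp]: "word_val G f [] = \<one>\<^bsub>G\<^esub>"
  by (simp add: word_val_def)

lemma word_val_Cons [simp]:
  "word_val G f ((s, b) # w) = (if b then f s else inv\<^bsub>G\<^esub> f s) \<otimes>\<^bsub>G\<^esub> word_val G f w"
  by (simp add: word_val_def)

lemma (in group) word_val_append:
  assumes "\<And>s. s \<in> S \<Longrightarrow> f s \<in> carrier G" "u \<in> lists (S \<times> UNIV)" "v \<in> lists (S \<times> UNIV)"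
  shows "word_val G f (u @ v) = word_val G f u \<otimes> word_val G f v"
  using assms(2)
proof (induction u)
  case Nil
  then show ?case using word_val_closed[of S f v] assms by simp
next
  case (Cons a u)
  then show ?case
    using word_val_closed[of S f] assms by (cases a) (auto simp: m_assoc)
qed

lemma word_val_cong:
  assumes "w \<in> lists (S \<times> UNIV)" "\<And>s. s \<in> S \<Longrightarrow> f s = g s"
  shows "word_val G f w = word_val G g w"
  using assms(1) by (induction w) (auto simp: assms(2))

text \<open>The hypotheses of von Dyck's theorem: values for the generators that kill the relators.
  The locale derives the induced homomorphism and its independence of the representative picked by
  \<open>presented_hom\<close>.\<close>

locale relator_map = group +
  fixes S :: "'s set" and R :: "('s \<times> bool) list set" and f :: "'s \<Rightarrow> 'a"
  assumes gen_closed: "s \<in> S \<Longrightarrow> f s \<in> carrier G"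
    and relator_one: "\<lbrakk>r \<in> R; r \<in> lists (S \<times> UNIV)\<rbrakk> \<Longrightarrow> word_val G f r = \<one>"
begin

lemma word_val_eq:
  assumes "word_eq S R u v"
  shows "word_val G f u = word_val G f v"
  using assms
proof (induction)
  case (cancel u v s b)
  have "word_val G f ([(s, b), (s, \<not> b)] @ v) = word_val G f v"
    using cancel gen_closed word_val_closed[of S f v]
    by (auto simp: m_assoc[symmetric])
  then show ?case
    using cancel gen_closed by (simp add: word_val_append[where S = S])
next
  case (relator u v r)
  then show ?case
    using gen_closed word_val_closed[of S f] by (simp add: word_val_append[where S = S] relator_one)
qed auto

lemma presented_hom_word_class:
  assumes "w \<in> lists (S \<times> UNIV)"
  shows "presented_hom G f (word_class S R w) = word_val G f w"
proof -
  have "word_eq S R w (SOME v. v \<in> word_class S R w)"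
    using someI[of "\<lambda>v. v \<in> word_class S R w" w] assms
    by (auto simp: word_class_def word_eq.refl)
  then show ?thesis
    unfolding presented_hom_def by (rule word_val_eq[symmetric])
qed

lemma presented_hom_hom: "presented_hom G f \<in> hom (presented_group S R) G"
proof (rule homI)
  fix x assume "x \<in> carrier (presented_group S R)"
  then obtain u where "u \<in> lists (S \<times> UNIV)" "x = word_class S R u"
    unfolding carrier_presented_group by blast
  then show "presented_hom G f x \<in> carrier G"
    using word_val_closed[of S f u] gen_closed by (simp add: presented_hom_word_class)
next
  fix x y assume "x \<in> carrier (presented_group S R)" "y \<in> carrier (presented_group S R)"
  then obtain u v where uv: "u \<in> lists (S \<times> UNIV)" "v \<in> lists (S \<times> UNIV)"
    "x = word_class S R u" "y = word_class S R v"
    unfolding carrier_presented_group by blast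
  then show "presented_hom G f (x \<otimes>\<^bsub>presented_group S R\<^esub> y) = presented_hom G f x \<otimes> presented_hom G f y"
    using word_val_append[of S f u v] gen_closed append_in_lists_conv[of u v "S \<times> UNIV"]
    by (simp add: mult_presented_group presented_hom_word_class del: in_lists_conv_set)
qed

lemma presented_hom_gen:
  assumes "s \<in> S"
  shows "presented_hom G f (word_class S R [(s, True)]) = f s"
  using assms gen_closed by (simp add: presented_hom_word_class)

end

lemma (in group_hom) hom_word_val:
  assumes "\<And>s. s \<in> S \<Longrightarrow> f s \<in> carrier G" "w \<in> lists (S \<times> UNIV)"
  shows "h (word_val G f w) = word_val H (h \<circ> f) w"
  using assms(2)
proof (induction w)
  case (Cons a w)
  then show ?case
    using G.word_val_closed[of S f w] assms(1) by (cases a) auto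
qed simp

text \<open>The class of a single inverse letter is the group inverse of the class of that letter,
  and concatenation is multiplication. Elements can henceforth be treated as products of generators
  rather than as sets of words.\<close>

lemma word_class_eq_word_val:
  assumes "w \<in> lists (S \<times> UNIV)"
  shows "word_class S R w = word_val (presented_group S R) (\<lambda>s. word_class S R [(s, True)]) w"
  using assms
proof (induction w)
  case Nil
  then show ?case by (simp add: one_presented_group)
next
  case (Cons a w)
  obtain s b where a: "a = (s, b)" by force
  have s: "s \<in> S" using Cons a by auto
  have "word_class S R [(s, False)] = inv\<^bsub>presented_group S R\<^esub> word_class S R [(s, True)]"
  proof (rule group.inv_equality[OF group_presented_group, symmetric])
    have "word_eq S R ([] @ [(s, False), (s, \<not> False)] @ []) ([] @ [])"
      using s by (intro word_eq.cancel) auto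
    then show "word_class S R [(s, False)] \<otimes>\<^bsub>presented_group S R\<^esub> word_class S R [(s, True)]
      = \<one>\<^bsub>presented_group S R\<^esub>"
      using s by (simp add: mult_presented_group one_presented_group word_class_eq_iff)
  qed (use s in \<open>auto simp: carrier_presented_group\<close>)
  moreover have "word_class S R (a # w) = word_class S R [a] \<otimes>\<^bsub>presented_group S R\<^esub> word_class S R w"
    using Cons mult_presented_group[of "[a]" S w R] by simp
  ultimately show ?case using Cons a by simp
qed

section \<open>The group \<open>W\<^sup>+\<close> and its bar automorphism\<close>

declare One_nat_def [simp del]

text \<open>The word \<sigma>_i ... \<sigma>_j whose square is a relator for \<open>i < j\<close>;
  it is empty when \<open>j < i\<close>, a case used later for \<open>pos_word 1 0\<close>.\<close>

definition pos_word :: "nat \<Rightarrow> nat \<Rightarrow> (nat \<times> bool) list" where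
  "pos_word i j = map (\<lambda>k. (k, True)) [i..<Suc j]"

lemma pos_word_words: "\<lbrakk>1 \<le> i; j < n\<rbrakk> \<Longrightarrow> pos_word i j \<in> lists ({1..<n} \<times> UNIV)"
  by (auto simp: pos_word_def in_lists_conv_set)

lemma (in group) relator_map_W:
  assumes "\<And>i. i \<in> {1..<n} \<Longrightarrow> f i \<in> carrier G"
    and "\<And>i j. \<lbrakk>1 \<le> i; i < j; j < n\<rbrakk> \<Longrightarrow> word_val G f (pos_word i j) \<otimes> word_val G f (pos_word i j) = \<one>"
  shows "relator_map G {1..<n} (W_relators n) f"
proof unfold_locales
  fix r assume "r \<in> W_relators n"
  then obtain i j where ij: "1 \<le> i" "i < j" "j < n" and r: "r = pos_word i j @ pos_word i j"
    unfolding W_relators_def pos_word_def by blast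
  have "word_val G f r = word_val G f (pos_word i j) \<otimes> word_val G f (pos_word i j)"
    unfolding r using ij by (intro word_val_append[where S = "{1..<n}"] assms pos_word_words) auto
  then show "word_val G f r = \<one>" using assms(2)[OF ij] by simp
qed (use assms in auto)

lemma group_Wplus: "group (Wplus n)"
  by (simp add: Wplus_def group_presented_group)

lemma W_gen_eq: "W_gen n i = word_class {1..<n} (W_relators n) [(i, True)]"
  by (simp add: W_gen_def word_class_def)

lemma W_gen_closed: "i \<in> {1..<n} \<Longrightarrow> W_gen n i \<in> carrier (Wplus n)"
  by (auto simp: W_gen_eq Wplus_def carrier_presented_group)

lemma word_class_Wplus:
  "w \<in> lists ({1..<n} \<times> UNIV)
    \<Longrightarrow> word_class {1..<n} (W_relators n) w = word_val (Wplus n) (W_gen n) w"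
  using word_class_eq_word_val[of w "{1..<n}" "W_relators n"]
  unfolding Wplus_def W_gen_def word_class_def .

lemma carrier_Wplus: "carrier (Wplus n) = word_val (Wplus n) (W_gen n) ` lists ({1..<n} \<times> UNIV)"
proof -
  have "word_class {1..<n} (W_relators n) ` lists ({1..<n} \<times> UNIV) =
      word_val (Wplus n) (W_gen n) ` lists ({1..<n} \<times> UNIV)"
    by (rule image_cong) (simp_all add: word_class_Wplus)
  then show ?thesis
    unfolding Wplus_def carrier_presented_group .
qed

lemma W_relation:
  assumes "1 \<le> i" "i < j" "j < n"
  shows "word_val (Wplus n) (W_gen n) (pos_word i j) \<otimes>\<^bsub>Wplus n\<^esub> word_val (Wplus n) (W_gen n) (pos_word i j)
    = \<one>\<^bsub>Wplus n\<^esub>"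
proof -
  let ?r = "pos_word i j"
  have r: "?r \<in> lists ({1..<n} \<times> UNIV)" using assms by (intro pos_word_words)
  have "word_eq {1..<n} (W_relators n) ([] @ (?r @ ?r) @ []) ([] @ [])"
  proof (rule word_eq.relator)
    show "?r @ ?r \<in> W_relators n"
      using assms unfolding W_relators_def pos_word_def by blast
  qed (use r in auto)
  then have "word_class {1..<n} (W_relators n) (?r @ ?r) = \<one>\<^bsub>Wplus n\<^esub>"
    using r by (simp add: Wplus_def one_presented_group word_class_eq_iff)
  moreover have "word_class {1..<n} (W_relators n) (?r @ ?r) = word_val (Wplus n) (W_gen n) (?r @ ?r)"
    using r by (intro word_class_Wplus) auto
  moreover have "word_val (Wplus n) (W_gen n) (?r @ ?r) =
      word_val (Wplus n) (W_gen n) ?r \<otimes>\<^bsub>Wplus n\<^esub> word_val (Wplus n) (W_gen n) ?r"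
    using r by (intro group.word_val_append[OF group_Wplus W_gen_closed])
  ultimately show ?thesis by simp
qed

lemma pos_word_rec: "i \<le> j \<Longrightarrow> pos_word i j = (i, True) # pos_word (Suc i) j"
  by (simp add: pos_word_def upt_conv_Cons del: upt_Suc)

text \<open>The formulas come from conjugation by rho_0 in a group generated by reflections with
  \<sigma>_i = rho_(i-1) rho_i, where rho_0 commutes with rho_j for \<open>j \<ge> 2\<close>: rho_0
  (rho_0 rho_1) rho_0 is the inverse of \<sigma>_1, and rho_0 (rho_1 rho_2) rho_0 = (rho_0
  rho_1)(rho_0 rho_1)(rho_1 rho_2).\<close>

definition bar_gen :: "nat \<Rightarrow> nat \<Rightarrow> (nat \<times> bool) list set" where
  "bar_gen n i = (if i = 1 then inv\<^bsub>Wplus n\<^esub> W_gen n 1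
     else if i = 2 then W_gen n 1 \<otimes>\<^bsub>Wplus n\<^esub> W_gen n 1 \<otimes>\<^bsub>Wplus n\<^esub> W_gen n 2
     else W_gen n i)"

lemma W_bar_eq: "W_bar n = presented_hom (Wplus n) (bar_gen n)"
  by (simp add: W_bar_def bar_gen_def[abs_def])

context
  fixes n :: nat
begin

interpretation W: group "Wplus n" by (rule group_Wplus)

abbreviation Wval :: "(nat \<times> bool) list \<Rightarrow> (nat \<times> bool) list set" where
  "Wval \<equiv> word_val (Wplus n) (W_gen n)"

lemma Wval_closed: "w \<in> lists ({1..<n} \<times> UNIV) \<Longrightarrow> Wval w \<in> carrier (Wplus n)"
  using W.word_val_closed[of "{1..<n}" "W_gen n" w] W_gen_closed by simp

lemma bar_gen_closed: "i \<in> {1..<n} \<Longrightarrow> bar_gen n i \<in> carrier (Wplus n)"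
  by (auto simp: bar_gen_def W_gen_closed)

lemma bar_val_tail: "3 \<le> i \<Longrightarrow> word_val (Wplus n) (bar_gen n) (pos_word i j) = Wval (pos_word i j)"
  by (rule word_val_cong[where S = "{3..}"]) (auto simp: bar_gen_def pos_word_def in_lists_conv_set)

text \<open>Only the leading factor changes, so the value is \<sigma>_1 \<sigma>_1 \<sigma>_2
  \<sigma>_3 ... \<sigma>_j; it is bracketed to expose the involution \<sigma>_1 ...
  \<sigma>_j.\<close>

lemma bar_val_two:
  assumes "2 \<le> j" "j < n"
  shows "word_val (Wplus n) (bar_gen n) (pos_word 2 j) =
    W_gen n 1 \<otimes>\<^bsub>Wplus n\<^esub> Wval (pos_word 1 j)"
proof -
  have "Wval (pos_word 3 j) \<in> carrier (Wplus n)" using assms by (intro Wval_closed pos_word_words) auto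
  moreover have "W_gen n 1 \<in> carrier (Wplus n)" "W_gen n 2 \<in> carrier (Wplus n)"
    using assms W_gen_closed by auto
  ultimately show ?thesis
    using assms pos_word_rec[of 1 j] pos_word_rec[of 2 j] bar_val_tail[of 3 j]
    by (simp add: bar_gen_def W.m_assoc numeral_eq_Suc One_nat_def)
qed

lemma bar_val_one:
  assumes "2 \<le> j" "j < n"
  shows "word_val (Wplus n) (bar_gen n) (pos_word 1 j) = Wval (pos_word 1 j)"
proof -
  have "Wval (pos_word 1 j) \<in> carrier (Wplus n)" using assms by (intro Wval_closed pos_word_words) auto
  moreover have "W_gen n 1 \<in> carrier (Wplus n)"
    using assms W_gen_closed by auto
  ultimately show ?thesis
    using assms pos_word_rec[of 1 j] bar_val_two[of j]
    by (simp add: bar_gen_def W.m_assoc[symmetric] numeral_eq_Suc One_nat_def)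
qed

text \<open>The products starting at 1 or at an index from 3 on have unchanged value, so their
  squares are trivial by the old relations. Only those starting at 2 need an argument.\<close>

lemma relator_map_bar: "relator_map (Wplus n) {1..<n} (W_relators n) (bar_gen n)"
proof (rule W.relator_map_W)
  fix i j :: nat
  assume ij: "1 \<le> i" "i < j" "j < n"
  let ?s = "W_gen n 1" and ?h = "Wval (pos_word 1 j)" and ?v = "word_val (Wplus n) (bar_gen n) (pos_word i j)"
  have s: "?s \<in> carrier (Wplus n)" using ij W_gen_closed by auto
  have h: "?h \<in> carrier (Wplus n)" using ij by (intro Wval_closed pos_word_words) auto
  have hh: "?h \<otimes>\<^bsub>Wplus n\<^esub> ?h = \<one>\<^bsub>Wplus n\<^esub>" using W_relation[of 1 j n] ij by simp
  consider "i = 1" | "i = 2" | "3 \<le> i" using ij by linarith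
  then show "?v \<otimes>\<^bsub>Wplus n\<^esub> ?v = \<one>\<^bsub>Wplus n\<^esub>"
  proof cases
    case 1
    then show ?thesis using hh bar_val_one[of j] ij by simp
  next
    case 2
    let ?t = "Wval (pos_word 2 j)"
    have t: "?t \<in> carrier (Wplus n)" using ij by (intro Wval_closed pos_word_words) auto
    have tt: "?t \<otimes>\<^bsub>Wplus n\<^esub> ?t = \<one>\<^bsub>Wplus n\<^esub>" using W_relation[of 2 j n] ij 2 by simp
    have hst: "?h = ?s \<otimes>\<^bsub>Wplus n\<^esub> ?t"
      using pos_word_rec[of 1 j] ij by (simp add: numeral_eq_Suc One_nat_def)
    have v: "?v = ?s \<otimes>\<^bsub>Wplus n\<^esub> ?h" using bar_val_two[of j] ij 2 by simp
    \<comment> \<open>Both \<open>t\<close> and \<open>h = s t\<close> are involutions, so \<open>s = h t\<close> and \<open>s h = h t h\<close>.\<close>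
    have "?h \<otimes>\<^bsub>Wplus n\<^esub> ?t = ?s"
      using hst s t tt by (simp add: W.m_assoc)
    then have "?v = ?h \<otimes>\<^bsub>Wplus n\<^esub> (?t \<otimes>\<^bsub>Wplus n\<^esub> ?h)" using v s t h by (simp add: W.m_assoc[symmetric])
    then have "?v \<otimes>\<^bsub>Wplus n\<^esub> ?v =
        ?h \<otimes>\<^bsub>Wplus n\<^esub> ?t \<otimes>\<^bsub>Wplus n\<^esub> (?h \<otimes>\<^bsub>Wplus n\<^esub> ?h) \<otimes>\<^bsub>Wplus n\<^esub> ?t \<otimes>\<^bsub>Wplus n\<^esub> ?h"
      using t h by (simp add: W.m_assoc)
    also have "\<dots> = ?h \<otimes>\<^bsub>Wplus n\<^esub> (?t \<otimes>\<^bsub>Wplus n\<^esub> ?t) \<otimes>\<^bsub>Wplus n\<^esub> ?h"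
      using t h hh by (simp add: W.m_assoc)
    also have "\<dots> = \<one>\<^bsub>Wplus n\<^esub>" using t h hh tt by simp
    finally show ?thesis .
  next
    case 3
    then show ?thesis using bar_val_tail W_relation[of i j n] ij by simp
  qed
qed (rule bar_gen_closed)

lemma W_bar_hom: "W_bar n \<in> hom (Wplus n) (Wplus n)"
  using relator_map.presented_hom_hom[OF relator_map_bar] by (simp add: W_bar_eq Wplus_def)

lemma W_bar_group_hom: "group_hom (Wplus n) (Wplus n) (W_bar n)"
  by (simp add: group_hom.intro group_hom_axioms_def group_Wplus W_bar_hom)

lemma W_bar_gen:
  assumes "i \<in> {1..<n}"
  shows "W_bar n (W_gen n i) = bar_gen n i"
  using relator_map.presented_hom_gen[OF relator_map_bar assms] by (simp add: W_bar_eq W_gen_eq)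

lemma W_bar_Wval:
  assumes "w \<in> lists ({1..<n} \<times> UNIV)"
  shows "W_bar n (Wval w) = word_val (Wplus n) (bar_gen n) w"
  using relator_map.presented_hom_word_class[OF relator_map_bar assms]
  by (simp add: W_bar_eq word_class_Wplus assms)

text \<open>For \<open>i \<ge> 2\<close> the product is fixed by the bar map, but it is also an
  involution, so fixed and inverted agree; for \<open>i = 1\<close> it is inverted by definition.
  The uniform form reflects that rho_0 conjugates rho_0 rho_i to its inverse.\<close>

lemma W_bar_pos_word:
  assumes "i \<in> {1..<n}"
  shows "W_bar n (Wval (pos_word 1 i)) = inv\<^bsub>Wplus n\<^esub> Wval (pos_word 1 i)"
proof (cases "i = 1")
  case True
  moreover have "pos_word 1 1 = [(1, True)]" by (simp add: pos_word_def One_nat_def)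
  ultimately show ?thesis using assms W_gen_closed[of 1 n] by (simp add: W_bar_gen bar_gen_def)
next
  case False
  then have i: "2 \<le> i" "i < n" using assms by auto
  have "Wval (pos_word 1 i) \<in> carrier (Wplus n)" using i by (intro Wval_closed pos_word_words) auto
  moreover have "Wval (pos_word 1 i) \<otimes>\<^bsub>Wplus n\<^esub> Wval (pos_word 1 i) = \<one>\<^bsub>Wplus n\<^esub>"
    using W_relation[of 1 i n] i by simp
  ultimately have "inv\<^bsub>Wplus n\<^esub> Wval (pos_word 1 i) = Wval (pos_word 1 i)"
    using W.inv_equality by blast
  moreover have "W_bar n (Wval (pos_word 1 i)) = Wval (pos_word 1 i)"
    using i bar_val_one[of i] W_bar_Wval[OF pos_word_words[of 1 i n]] by simp
  ultimately show ?thesis by (simp only:)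
qed

lemma W_bar_bar_gen:
  assumes "i \<in> {1..<n}"
  shows "W_bar n (bar_gen n i) = W_gen n i"
proof -
  interpret bar: group_hom "Wplus n" "Wplus n" "W_bar n" by (rule W_bar_group_hom)
  consider "i = 1" | "i = 2" | "3 \<le> i" using assms unfolding atLeastLessThan_iff by linarith
  then show ?thesis
  proof cases
    case 1
    then show ?thesis using assms W_gen_closed[of 1 n] by (simp add: bar_gen_def W_bar_gen)
  next
    case 2
    then have g: "W_gen n 1 \<in> carrier (Wplus n)" "W_gen n 2 \<in> carrier (Wplus n)"
      using assms W_gen_closed by auto
    then have "inv\<^bsub>Wplus n\<^esub> W_gen n 1 \<otimes>\<^bsub>Wplus n\<^esub> (inv\<^bsub>Wplus n\<^esub> W_gen n 1 \<otimes>\<^bsub>Wplus n\<^esub>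
        (W_gen n 1 \<otimes>\<^bsub>Wplus n\<^esub> (W_gen n 1 \<otimes>\<^bsub>Wplus n\<^esub> W_gen n 2))) = W_gen n 2"
      by (simp add: W.m_assoc[symmetric])
    then show ?thesis using 2 assms g by (simp add: bar_gen_def W_bar_gen W.m_assoc)
  next
    case 3
    then show ?thesis using assms by (simp add: bar_gen_def W_bar_gen)
  qed
qed

lemma W_bar_involution:
  assumes "x \<in> carrier (Wplus n)"
  shows "W_bar n (W_bar n x) = x"
proof -
  interpret bar: group_hom "Wplus n" "Wplus n" "W_bar n" by (rule W_bar_group_hom)
  obtain w where w: "w \<in> lists ({1..<n} \<times> UNIV)" "x = Wval w"
    using assms unfolding carrier_Wplus by blast
  have "W_bar n (W_bar n x) = word_val (Wplus n) (W_bar n \<circ> bar_gen n) w"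
    using w bar.hom_word_val[of "{1..<n}" "bar_gen n" w] by (simp add: W_bar_Wval bar_gen_closed)
  also have "\<dots> = x"
    unfolding w(2) using w(1) by (rule word_val_cong) (simp add: W_bar_bar_gen)
  finally show ?thesis .
qed

end

section \<open>Quotients by normal subgroups\<close>

text \<open>The purely group-theoretic core, to be used with \<open>G\<close> =
  \<open>W\<^sup>+\<close>, \<open>H\<close> the rotation group of \<open>Q\<close>, and the kernel
  of \<pi> in the role of \<open>K\<close>.\<close>

lemma (in group) chirality_quotient_iso:
  assumes M: "M \<lhd> G"
    and \<pi>: "group_hom G H \<pi>" "\<pi> ` carrier G = carrier H"
    and H: "simple_group H"
    and \<beta>: "group_hom G G \<beta>" "\<And>x. x \<in> carrier G \<Longrightarrow> \<beta> (\<beta> x) = x"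
    and "\<beta> ` M \<noteq> M"
    and N: "\<beta> ` (M \<inter> kernel G H \<pi>) = M \<inter> kernel G H \<pi>"
  shows "G\<lparr>carrier := M <#> \<beta> ` M\<rparr> Mod M \<cong> H"
proof -
  interpret \<pi>: group_hom G H \<pi> by (rule \<pi>)
  interpret \<beta>: group_hom G G \<beta> by (rule \<beta>)
  interpret H: simple_group H by (rule H)
  interpret M: normal M G by (rule M)
  let ?K = "kernel G H \<pi>" and ?M' = "\<beta> ` M"
  have MG: "M \<subseteq> carrier G" by (rule M.subset)
  \<comment> \<open>An involutory endomorphism is onto; hence the image of the normal subgroup
    \<open>M\<close> is again normal.\<close>
  have surj\<beta>: "\<beta> ` carrier G = carrier G"
  proof
    show "carrier G \<subseteq> \<beta> ` carrier G"
      using \<beta>(2) \<beta>.hom_closed by (metis image_eqI subsetI)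
  qed auto
  have M': "?M' \<lhd> G" using M.surj_hom_normal_subgroup[OF \<beta>(1) surj\<beta>] .
  have "(\<lambda>x. \<beta> (\<beta> x)) ` M = (\<lambda>x. x) ` M"
    by (rule image_cong) (use \<beta>(2) MG in auto)
  then have \<beta>\<beta>: "\<beta> ` \<beta> ` M = M" by (simp add: image_image)
  have not_le: "\<not> M \<subseteq> ?M'"
  proof
    assume "M \<subseteq> ?M'"
    then have "\<beta> ` M \<subseteq> \<beta> ` \<beta> ` M" by (rule image_mono)
    then show False using \<beta>\<beta> \<open>M \<subseteq> ?M'\<close> assms(7) by auto
  qed
  have img: "\<pi> ` L = carrier H \<or> \<pi> ` L = {\<one>\<^bsub>H\<^esub>}" if "L \<lhd> G" for L
    using normal.surj_hom_normal_subgroup[OF that \<pi>] by (rule H.no_real_normal_subgroup)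
  \<comment> \<open>A trivial image would put \<open>M\<close> inside the kernel, so the invariant
    intersection would be \<open>M\<close> itself.\<close>
  have surjM: "\<pi> ` M = carrier H"
  proof (rule ccontr)
    assume "\<pi> ` M \<noteq> carrier H"
    then have "\<pi> ` M = {\<one>\<^bsub>H\<^esub>}" using img[OF M] by blast
    then have "M \<inter> ?K = M" using MG by (auto simp: kernel_def)
    then show False using N assms(7) by simp
  qed
  have "M \<inter> ?K \<subseteq> M \<inter> ?M'"
    using N by blast
  moreover have "M \<inter> ?M' \<subseteq> M \<inter> ?K"
  proof -
    \<comment> \<open>If the intersection mapped onto \<open>H\<close>, each \<open>m\<close> in
      \<open>M\<close> would agree under \<pi> with some \<open>x\<close> in
      \<open>M \<inter> ?M'\<close>. Then \<open>m \<otimes> inv x\<close> lies in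
      \<open>M \<inter> ?K\<close>, which is inside \<open>?M'\<close> by invariance, forcing
      \<open>m\<close> into \<open>?M'\<close>.\<close>
    have "\<pi> ` (M \<inter> ?M') \<noteq> carrier H"
    proof
      assume surj: "\<pi> ` (M \<inter> ?M') = carrier H"
      have "m \<in> ?M'" if m: "m \<in> M" for m
      proof -
        have "\<pi> m \<in> \<pi> ` (M \<inter> ?M')" using surj m MG by auto
        then obtain x where x: "x \<in> M" "x \<in> ?M'" "\<pi> m = \<pi> x" by auto
        have c: "m \<in> carrier G" "x \<in> carrier G" using m x MG by auto
        then have "m \<otimes> inv x \<in> M \<inter> ?K" using m x by (simp add: kernel_def)
        then have "m \<otimes> inv x \<in> ?M'" using N by blast
        then have "m \<otimes> inv x \<otimes> x \<in> ?M'"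
          using x M' by (meson normal_imp_subgroup subgroup.m_closed)
        then show ?thesis using c by (simp add: m_assoc)
      qed
      then show False using not_le by blast
    qed
    then have "\<pi> ` (M \<inter> ?M') = {\<one>\<^bsub>H\<^esub>}"
      using img[OF normal_subgroup_intersect[OF M M']] by blast
    then show ?thesis using MG by (auto simp: kernel_def)
  qed
  ultimately have int: "M \<inter> ?M' = M \<inter> ?K" by (rule subset_antisym[rotated])
  have sub': "subgroup ?M' G" using M' by (rule normal_imp_subgroup)
  interpret second_isomorphism_grp M G ?M'
    by (simp add: second_isomorphism_grp_def second_isomorphism_grp_axioms_def M sub')
  let ?GM' = "G\<lparr>carrier := ?M'\<rparr>"
  interpret M': group ?GM' using sub' by (rule subgroup_imp_group)
  \<comment> \<open>\<beta> carries \<open>?M'\<close> back onto \<open>M\<close>, so composing with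
    \<pi> maps \<open>?M'\<close> onto \<open>H\<close>. The kernel is the \<beta>-image of
    \<open>M \<inter> ?K\<close>, which is \<open>M \<inter> ?M'\<close>.\<close>
  have hom: "group_hom ?GM' H (\<pi> \<circ> \<beta>)"
  proof (rule group_hom.intro)
    have "\<pi> \<circ> \<beta> \<in> hom ?GM' H"
    proof (rule homI)
      show "(\<pi> \<circ> \<beta>) x \<in> carrier H" if "x \<in> carrier ?GM'" for x
        using that subgroup.mem_carrier[OF sub'] by simp
      show "(\<pi> \<circ> \<beta>) (x \<otimes>\<^bsub>?GM'\<^esub> y) = (\<pi> \<circ> \<beta>) x \<otimes>\<^bsub>H\<^esub> (\<pi> \<circ> \<beta>) y"
        if "x \<in> carrier ?GM'" "y \<in> carrier ?GM'" for x y
        using that subgroup.mem_carrier[OF sub', of x] subgroup.mem_carrier[OF sub', of y] by simp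
    qed
    then show "group_hom_axioms ?GM' H (\<pi> \<circ> \<beta>)" by (simp add: group_hom_axioms_def)
  qed (rule M'.group_axioms \<pi>.H.group_axioms)+
  have "(\<pi> \<circ> \<beta>) ` carrier ?GM' = carrier H"
    using surjM \<beta>\<beta> image_comp[of \<pi> \<beta> ?M'] by simp
  then have quot: "?GM' Mod kernel ?GM' H (\<pi> \<circ> \<beta>) \<cong> H" by (rule group_hom.FactGroup_iso[OF hom])
  have "kernel ?GM' H (\<pi> \<circ> \<beta>) = \<beta> ` (M \<inter> ?K)"
  proof (intro equalityI subsetI)
    fix x assume "x \<in> kernel ?GM' H (\<pi> \<circ> \<beta>)"
    then obtain m where m: "m \<in> M" "x = \<beta> m" "\<pi> (\<beta> (\<beta> m)) = \<one>\<^bsub>H\<^esub>"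
      by (auto simp: kernel_def)
    then have "m \<in> M \<inter> ?K" using \<beta>(2)[of m] MG by (auto simp: kernel_def)
    then show "x \<in> \<beta> ` (M \<inter> ?K)" using m(2) by simp
  next
    fix x assume "x \<in> \<beta> ` (M \<inter> ?K)"
    then obtain m where "m \<in> M" "m \<in> ?K" "x = \<beta> m" by blast
    then show "x \<in> kernel ?GM' H (\<pi> \<circ> \<beta>)" using \<beta>(2)[of m] by (simp add: kernel_def)
  qed
  then have ker: "kernel ?GM' H (\<pi> \<circ> \<beta>) = M \<inter> ?M'" using N int by simp
  \<comment> \<open>The second isomorphism theorem turns the quotient of \<open>?M'\<close> into the
    chirality group.\<close>
  have "?GM' Mod (M \<inter> ?M') \<cong> G\<lparr>carrier := M <#> ?M'\<rparr> Mod M"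
    using normal_intersection_quotient_isom by (rule is_isoI)
  moreover have "group (?GM' Mod (M \<inter> ?M'))"
    using normal_subgrp_intersection_normal by (simp add: Int_commute normal.factorgroup_is_group)
  ultimately show ?thesis
    using quot ker by (metis group.iso_sym iso_trans)
qed

section \<open>Chiral polytopes\<close>

locale chiral = polytope +
  fixes \<Phi> :: "'a set"
  assumes chiral: "chiral_polytope n P" and base: "\<Phi> \<in> flags P"
begin

section \<open>The two flag orbits and existence of the standard rotations\<close>

abbreviation orb :: "'a set \<Rightarrow> 'a set set" where
  "orb \<equiv> orbit (aut_group P) (\<lambda>f \<Phi>. f ` \<Phi>)"

lemma orb_image:
  assumes f: "f \<in> carrier (aut_group P)" and \<Psi>: "\<Psi> \<in> flags P"
  shows "orb (f ` \<Psi>) = orb \<Psi>"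
proof (intro equalityI subsetI)
  fix \<Theta> assume "\<Theta> \<in> orb (f ` \<Psi>)"
  then obtain g where g: "g \<in> carrier (aut_group P)" "\<Theta> = g ` f ` \<Psi>"
    unfolding orbit_def by blast
  then have "\<Theta> = (f \<otimes>\<^bsub>aut_group P\<^esub> g) ` \<Psi>" using image_mult[OF \<Psi>] by simp
  then show "\<Theta> \<in> orb \<Psi>" using f g(1) unfolding orbit_def by blast
next
  fix \<Theta> assume "\<Theta> \<in> orb \<Psi>"
  then obtain g where g: "g \<in> carrier (aut_group P)" "\<Theta> = g ` \<Psi>"
    unfolding orbit_def by blast
  let ?h = "inv\<^bsub>aut_group P\<^esub> f \<otimes>\<^bsub>aut_group P\<^esub> g"
  have "f \<otimes>\<^bsub>aut_group P\<^esub> ?h = g" using f g(1) by (simp add: aut.m_assoc[symmetric])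
  then have "\<Theta> = ?h ` f ` \<Psi>" using g image_mult[OF \<Psi>, of f ?h] by simp
  moreover have "?h \<in> carrier (aut_group P)" using f g(1) by simp
  ultimately show "\<Theta> \<in> orb (f ` \<Psi>)" unfolding orbit_def by blast
qed

lemma orb_eqD:
  assumes "orb \<Psi> = orb \<Theta>" "\<Theta> \<in> flags P"
  obtains f where "f \<in> carrier (aut_group P)" "f ` \<Psi> = \<Theta>"
proof -
  have "\<one>\<^bsub>aut_group P\<^esub> ` \<Theta> \<in> orb \<Theta>" unfolding orbit_def by blast
  then have "\<Theta> \<in> orb \<Psi>" using assms image_one by simp
  then show ?thesis using that unfolding orbit_def by blast
qed

lemma card_orbs: "card (orb ` flags P) = 2"
proof -
  have "orbits (aut_group P) (flags P) (\<lambda>f \<Phi>. f ` \<Phi>) = orb ` flags P"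
    unfolding orbits_def by blast
  then show ?thesis using chiral by (simp add: chiral_polytope_def)
qed

lemma orb_adj: "\<lbrakk>\<Psi> \<in> flags P; i < n\<rbrakk> \<Longrightarrow> orb (adj P i \<Psi>) \<noteq> orb \<Psi>"
  using chiral adjacent_adj[of \<Psi> i] unfolding chiral_polytope_def by metis

text \<open>Three different orbits are impossible, so two successive changes of orbit lead back to
  the first one.\<close>

lemma two_orbits:
  assumes "\<Psi> \<in> flags P" "\<Theta> \<in> flags P" "\<Lambda> \<in> flags P" "orb \<Psi> \<noteq> orb \<Theta>" "orb \<Theta> \<noteq> orb \<Lambda>"
  shows "orb \<Psi> = orb \<Lambda>"
proof (rule ccontr)
  assume "orb \<Psi> \<noteq> orb \<Lambda>"
  then have "card {orb \<Psi>, orb \<Theta>, orb \<Lambda>} = 3" using assms by simp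
  moreover have "{orb \<Psi>, orb \<Theta>, orb \<Lambda>} \<subseteq> orb ` flags P" using assms by simp
  moreover have "finite (orb ` flags P)" using card_orbs by (intro card_ge_0_finite) simp
  ultimately show False
    using card_mono[of "orb ` flags P" "{orb \<Psi>, orb \<Theta>, orb \<Lambda>}"] card_orbs by simp
qed

text \<open>For \<open>n = 0\<close> there is no exchange move, so connectivity leaves one flag and
  hence one orbit. Positivity makes the flag \<open>adj P 0 \<Phi>\<close> available.\<close>

lemma n_pos: "0 < n"
proof (rule ccontr)
  assume "\<not> 0 < n"
  then have "\<Psi> = \<Phi>" if "\<Psi> \<in> flags P" for \<Psi>
    using base that by (rule_tac flag_induct[of \<Phi> \<Psi> "\<lambda>\<Gamma>. \<Gamma> = \<Phi>"]) auto
  then have "orb ` flags P = {orb \<Phi>}" using base by blast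
  then show False using card_orbs by simp
qed

text \<open>Each of the two exchanges switches the orbit, so the target flag lies in the orbit of
  \<Phi>; an automorphism is determined by the image of one flag. This justifies the definite
  description in \<open>std_rot\<close>.\<close>

lemma std_rot:
  assumes "i \<in> {1..<n}"
  shows "std_rot P \<Phi> i \<in> carrier (aut_group P)"
    and "std_rot P \<Phi> i ` \<Phi> = adj P (i - 1) (adj P i \<Phi>)"
proof -
  let ?Q = "\<lambda>f. f \<in> carrier (aut_group P) \<and> f ` \<Phi> = adj P (i - 1) (adj P i \<Phi>)"
  have i: "i < n" "i - 1 < n" using assms by auto
  have fl: "adj P i \<Phi> \<in> flags P" "adj P (i - 1) (adj P i \<Phi>) \<in> flags P"
    using adj_flag i base by auto
  have "orb \<Phi> = orb (adj P (i - 1) (adj P i \<Phi>))"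
    using two_orbits[OF base fl] orb_adj[OF base i(1)] orb_adj[OF fl(1) i(2)] by metis
  then obtain f where f: "f \<in> carrier (aut_group P)" "f ` \<Phi> = adj P (i - 1) (adj P i \<Phi>)"
    by (rule orb_eqD[OF _ fl(2)])
  have "?Q (std_rot P \<Phi> i)"
    unfolding std_rot_def
  proof (rule theI[of ?Q f])
    show "?Q f" using f by (rule conjI)
    show "g = f" if "?Q g" for g
      using that f aut_determined[OF _ f(1) base, of g] by simp
  qed
  then show "std_rot P \<Phi> i \<in> carrier (aut_group P)"
    "std_rot P \<Phi> i ` \<Phi> = adj P (i - 1) (adj P i \<Phi>)" by blast+
qed

section \<open>Products of standard rotations and the relations of \<open>W\<^sup>+\<close>\<close>

abbreviation rot_val :: "(nat \<times> bool) list \<Rightarrow> 'a \<Rightarrow> 'a" where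
  "rot_val \<equiv> word_val (aut_group P) (std_rot P \<Phi>)"

lemma rot_val_closed: "w \<in> lists ({1..<n} \<times> UNIV) \<Longrightarrow> rot_val w \<in> carrier (aut_group P)"
  using std_rot(1) by (rule aut.word_val_closed)

text \<open>\<sigma>_i commutes with the exchange at \<open>i - 1\<close>, and that exchange undoes
  the second move in the image of \<Phi> under \<sigma>_i.\<close>

lemma std_rot_adj:
  assumes "i \<in> {1..<n}"
  shows "std_rot P \<Phi> i ` adj P (i - 1) \<Phi> = adj P i \<Phi>"
proof -
  have i: "i < n" "i - 1 < n" using assms by auto
  show ?thesis
    using aut_adj[OF std_rot(1)[OF assms] base i(2)] std_rot(2)[OF assms] adj_adj[OF adj_flag[OF base i(1)] i(2)]
    by simp
qed

text \<open>
  Each \<open>\<sigma>\<^sub>i\<close> maps \<open>\<Phi>\<^sup>i\<^sup>-\<^sup>1\<close> to \<open>\<Phi>\<^sup>i\<close>, so the product telescopes.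
\<close>

lemma rot_val_adj:
  assumes "1 \<le> i" "i \<le> j" "j < n"
  shows "rot_val (pos_word i j) ` adj P (i - 1) \<Phi> = adj P j \<Phi>"
  using assms(2,1)
proof (induction i rule: inc_induct)
  case base
  have j: "j \<in> {1..<n}" "j - 1 < n" using assms by auto
  have "rot_val (pos_word j j) = std_rot P \<Phi> j"
    using std_rot(1)[OF j(1)] by (simp add: pos_word_def)
  then show ?case using std_rot_adj[OF j(1)] by simp
next
  case (step i)
  have i: "i \<in> {1..<n}" "i - 1 < n" using step assms by auto
  have "rot_val (pos_word i j) ` adj P (i - 1) \<Phi> =
      rot_val (pos_word (Suc i) j) ` std_rot P \<Phi> i ` adj P (i - 1) \<Phi>"
    using pos_word_rec[of i j] step image_mult[OF adj_flag[OF base i(2)]] by simp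
  then show ?case using std_rot_adj[OF i(1)] step by simp
qed

text \<open>The product acts on \<Phi> as the exchange at \<open>j\<close> followed by the one at
  \<open>k = i - 1\<close>. Applying it twice performs both exchanges twice; they commute because
  \<open>i < j\<close> gives \<open>k + 2 \<le> j\<close>, so everything cancels.\<close>

lemma rot_val_relation:
  assumes "1 \<le> i" "i < j" "j < n"
  shows "rot_val (pos_word i j) \<otimes>\<^bsub>aut_group P\<^esub> rot_val (pos_word i j) = \<one>\<^bsub>aut_group P\<^esub>"
proof (rule aut_fixes_flag[OF _ base])
  let ?v = "rot_val (pos_word i j)"
  define k where "k = i - 1"
  have k: "k < n" "k + 2 \<le> j" using assms by (auto simp: k_def)
  have v: "?v \<in> carrier (aut_group P)" using assms by (intro rot_val_closed pos_word_words) auto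
  then show "?v \<otimes>\<^bsub>aut_group P\<^esub> ?v \<in> carrier (aut_group P)" by simp
  note fj = adj_flag[OF base assms(3)]
  note fv = aut_flag[OF v base]
  have "adj P k (?v ` \<Phi>) = adj P j \<Phi>"
    using aut_adj[OF v base k(1)] rot_val_adj[of i j] assms by (simp add: k_def)
  then have v\<Phi>: "?v ` \<Phi> = adj P k (adj P j \<Phi>)"
    using adj_adj[OF fv k(1)] by simp
  have "(?v \<otimes>\<^bsub>aut_group P\<^esub> ?v) ` \<Phi> = ?v ` adj P k (adj P j \<Phi>)"
    using image_mult[OF base] v\<Phi> by simp
  also have "\<dots> = adj P k (adj P j (?v ` \<Phi>))"
    using aut_adj[OF v fj k(1)] aut_adj[OF v base assms(3)] by simp
  also have "\<dots> = adj P j (adj P k (?v ` \<Phi>))"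
    using adj_commute[OF fv k(1) assms(3) k(2)] .
  also have "\<dots> = \<Phi>"
    using v\<Phi> adj_adj[OF fj k(1)] adj_adj[OF base assms(3)] by simp
  finally show "(?v \<otimes>\<^bsub>aut_group P\<^esub> ?v) ` \<Phi> = \<Phi>" .
qed

section \<open>The projection of \<open>W\<^sup>+\<close> onto the automorphism group and the
  labelling of flags by its elements\<close>

abbreviation proj :: "(nat \<times> bool) list set \<Rightarrow> 'a \<Rightarrow> 'a" where
  "proj \<equiv> presented_hom (aut_group P) (std_rot P \<Phi>)"

lemma relator_map_rot: "relator_map (aut_group P) {1..<n} (W_relators n) (std_rot P \<Phi>)"
  using std_rot(1) rot_val_relation by (rule aut.relator_map_W)

lemma proj_group_hom: "group_hom (Wplus n) (aut_group P) proj"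
  using relator_map.presented_hom_hom[OF relator_map_rot]
  by (simp add: group_hom.intro group_hom_axioms_def group_Wplus group_aut Wplus_def[symmetric])

sublocale proj: group_hom "Wplus n" "aut_group P" proj
  by (rule proj_group_hom)

sublocale bar: group_hom "Wplus n" "Wplus n" "W_bar n"
  by (rule W_bar_group_hom)

text \<open>\<sigma>_1 ... \<sigma>_i stands for rho_0 rho_i, though neither reflection exists here.
  The empty product at \<open>i = 0\<close> lets all exchanges be treated alike.\<close>

definition tele :: "nat \<Rightarrow> (nat \<times> bool) list set" where
  "tele i = word_val (Wplus n) (W_gen n) (pos_word 1 i)"

lemma tele_closed: "i < n \<Longrightarrow> tele i \<in> carrier (Wplus n)"
  unfolding tele_def by (intro Wval_closed pos_word_words) auto

lemma tele_0: "tele 0 = \<one>\<^bsub>Wplus n\<^esub>"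
  by (simp add: tele_def pos_word_def)

lemma bar_tele: "i < n \<Longrightarrow> W_bar n (tele i) = inv\<^bsub>Wplus n\<^esub> tele i"
  using W_bar_pos_word[of i n] tele_0 by (cases "i = 0") (auto simp: tele_def)

lemma proj_tele:
  assumes "i < n"
  shows "proj (tele i) = rot_val (pos_word 1 i)"
proof -
  have w: "pos_word 1 i \<in> lists ({1..<n} \<times> UNIV)" using assms by (intro pos_word_words) auto
  show ?thesis
    using relator_map.presented_hom_word_class[OF relator_map_rot w] word_class_Wplus[OF w]
    by (simp add: tele_def)
qed

lemma proj_tele_image:
  assumes "i < n"
  shows "proj (tele i) ` adj P 0 \<Phi> = adj P i \<Phi>"
proof (cases "i = 0")
  case True
  then show ?thesis using image_one[OF adj_flag[OF base n_pos]] by (simp add: tele_0)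
next
  case False
  then show ?thesis using rot_val_adj[of 1 i] assms by (simp add: proj_tele)
qed

lemma proj_closed: "x \<in> carrier (Wplus n) \<Longrightarrow> proj x \<in> carrier (aut_group P)"
  by simp

lemma base0: "adj P 0 \<Phi> \<in> flags P"
  using adj_flag[OF base n_pos] .

text \<open>The exchange commutes with \<open>proj x\<close>, and \<open>tele i\<close> takes the
  0-adjacent flag to the \<open>i\<close>-adjacent one. So an exchange becomes left multiplication
  of the label together with a switch of the base flag.\<close>

lemma adj_even:
  assumes x: "x \<in> carrier (Wplus n)" and i: "i < n"
  shows "adj P i (proj x ` \<Phi>) = proj (tele i \<otimes>\<^bsub>Wplus n\<^esub> x) ` adj P 0 \<Phi>"
  using aut_adj[OF proj_closed[OF x] base i] image_mult[OF base0] proj_tele_image[OF i]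
    x tele_closed[OF i] by simp

text \<open>Solves \<open>adj_even\<close> for the other base flag, since exchanges are involutions;
  the factor therefore becomes the inverse of \<open>tele i\<close>.\<close>

lemma adj_odd:
  assumes x: "x \<in> carrier (Wplus n)" and i: "i < n"
  shows "adj P i (proj x ` adj P 0 \<Phi>) = proj (inv\<^bsub>Wplus n\<^esub> tele i \<otimes>\<^bsub>Wplus n\<^esub> x) ` \<Phi>"
proof -
  note t = tele_closed[OF i]
  let ?y = "inv\<^bsub>Wplus n\<^esub> tele i \<otimes>\<^bsub>Wplus n\<^esub> x"
  have y: "?y \<in> carrier (Wplus n)" using x t by simp
  have "tele i \<otimes>\<^bsub>Wplus n\<^esub> ?y = x" using x t by (simp add: proj.m_assoc[symmetric])
  then have "adj P i (proj ?y ` \<Phi>) = proj x ` adj P 0 \<Phi>"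
    using adj_even[OF y i] by simp
  then show ?thesis using adj_adj[OF aut_flag[OF proj_closed[OF y] base] i] by simp
qed

text \<open>The flags of these two shapes include \<Phi> and are closed under exchanges by
  \<open>adj_even\<close> and \<open>adj_odd\<close>, so connectivity gives all flags.\<close>

lemma flag_cases:
  assumes "\<Psi> \<in> flags P"
  obtains x where "x \<in> carrier (Wplus n)" "\<Psi> = proj x ` \<Phi>"
  | x where "x \<in> carrier (Wplus n)" "\<Psi> = proj x ` adj P 0 \<Phi>"
proof -
  let ?Q = "\<lambda>\<Psi>. \<exists>x \<in> carrier (Wplus n). \<Psi> = proj x ` \<Phi> \<or> \<Psi> = proj x ` adj P 0 \<Phi>"
  have "?Q \<Psi>"
  proof (rule flag_induct[OF base assms, of ?Q])
    show "?Q \<Phi>" using image_one[OF base] by (intro bexI[of _ "\<one>\<^bsub>Wplus n\<^esub>"]) auto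
  next
    fix \<Gamma> i assume i: "i < n" and "?Q \<Gamma>"
    then obtain x where x: "x \<in> carrier (Wplus n)" "\<Gamma> = proj x ` \<Phi> \<or> \<Gamma> = proj x ` adj P 0 \<Phi>"
      by blast
    have "tele i \<otimes>\<^bsub>Wplus n\<^esub> x \<in> carrier (Wplus n)" "inv\<^bsub>Wplus n\<^esub> tele i \<otimes>\<^bsub>Wplus n\<^esub> x \<in> carrier (Wplus n)"
      using x(1) tele_closed[OF i] by simp_all
    then show "?Q (adj P i \<Gamma>)"
      using x(2) adj_even[OF x(1) i] adj_odd[OF x(1) i] by metis
  qed
  then show ?thesis using that by blast
qed

text \<open>Chirality puts \<Phi> and its 0-adjacent flag in different orbits, so the two shapes
  never coincide.\<close>

lemma even_odd:
  assumes "f \<in> carrier (aut_group P)" "g \<in> carrier (aut_group P)"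
  shows "f ` \<Phi> \<noteq> g ` adj P 0 \<Phi>"
  using orb_image[OF assms(1) base] orb_image[OF assms(2) base0] orb_adj[OF base n_pos] by metis

text \<open>The image of \<Phi> under an automorphism cannot be of the second shape, so it is the
  image under some \<open>proj x\<close>, and agreement on one flag means equality.\<close>

lemma proj_surj: "proj ` carrier (Wplus n) = carrier (aut_group P)"
proof (intro equalityI subsetI)
  fix f assume f: "f \<in> carrier (aut_group P)"
  show "f \<in> proj ` carrier (Wplus n)"
  proof (rule flag_cases[OF aut_flag[OF f base]])
    fix x assume x: "x \<in> carrier (Wplus n)" "f ` \<Phi> = proj x ` \<Phi>"
    then show ?thesis using aut_determined[OF f proj_closed[OF x(1)] base] by blast
  next
    fix x assume x: "x \<in> carrier (Wplus n)" "f ` \<Phi> = proj x ` adj P 0 \<Phi>"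
    then show ?thesis using even_odd[OF f proj_closed[OF x(1)]] by blast
  qed
qed auto

text \<open>
  If \<open>M\<close> is invariant, the bar automorphism descends to an automorphism \<open>\<beta>\<close> of the rotation group,
  and \<open>\<Phi> g \<mapsto> \<Phi>\<^sup>0 \<beta>(g)\<close>, \<open>\<Phi>\<^sup>0 g \<mapsto> \<Phi> \<beta>(g)\<close> preserves adjacency, because
  \<open>\<Phi>\<^sup>0 \<sigma>\<^sub>1 \<dots> \<sigma>\<^sub>i = \<Phi>\<^sup>i\<close> and \<open>\<beta>\<close> inverts \<open>\<sigma>\<^sub>1 \<dots> \<sigma>\<^sub>i\<close>. It is therefore induced by a reflection of \<open>P\<close>.
\<close>

lemma kernel_not_bar_invariant:
  "W_bar n ` W_kernel n (aut_group P) (std_rot P \<Phi>) \<noteq> W_kernel n (aut_group P) (std_rot P \<Phi>)"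
proof
  let ?M = "kernel (Wplus n) (aut_group P) proj"
  let ?\<Phi>0 = "adj P 0 \<Phi>"
  assume "W_bar n ` W_kernel n (aut_group P) (std_rot P \<Phi>) = W_kernel n (aut_group P) (std_rot P \<Phi>)"
  then have M: "W_bar n ` ?M = ?M" by (simp add: W_kernel_def)
  \<comment> \<open>Invariance of the kernel enters here: the bar map descends to the quotient, so
    \<tau> will not depend on the chosen labels.\<close>
  have bar_eq: "proj (W_bar n x) = proj (W_bar n y)"
    if x: "x \<in> carrier (Wplus n)" and y: "y \<in> carrier (Wplus n)" and eq: "proj x = proj y" for x y
  proof -
    have "x \<otimes>\<^bsub>Wplus n\<^esub> inv\<^bsub>Wplus n\<^esub> y \<in> ?M" using x y eq by (simp add: kernel_def)
    then have "W_bar n (x \<otimes>\<^bsub>Wplus n\<^esub> inv\<^bsub>Wplus n\<^esub> y) \<in> ?M" using M by blast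
    then have "proj (W_bar n x) \<otimes>\<^bsub>aut_group P\<^esub> inv\<^bsub>aut_group P\<^esub> proj (W_bar n y) = \<one>\<^bsub>aut_group P\<^esub>"
      using x y by (simp add: kernel_def)
    then show ?thesis using x y by (metis aut.inv_closed aut.inv_equality aut.inv_inv bar.hom_closed proj_closed)
  qed
  define \<tau> where "\<tau> \<Psi> = (if \<exists>x \<in> carrier (Wplus n). \<Psi> = proj x ` \<Phi>
    then proj (W_bar n (SOME x. x \<in> carrier (Wplus n) \<and> \<Psi> = proj x ` \<Phi>)) ` ?\<Phi>0
    else proj (W_bar n (SOME x. x \<in> carrier (Wplus n) \<and> \<Psi> = proj x ` ?\<Phi>0)) ` \<Phi>)" for \<Psi>
  have \<tau>_even: "\<tau> (proj x ` \<Phi>) = proj (W_bar n x) ` ?\<Phi>0" if x: "x \<in> carrier (Wplus n)" for x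
  proof -
    define y where "y = (SOME y. y \<in> carrier (Wplus n) \<and> proj x ` \<Phi> = proj y ` \<Phi>)"
    have y: "y \<in> carrier (Wplus n) \<and> proj x ` \<Phi> = proj y ` \<Phi>"
      unfolding y_def by (rule someI[of _ x]) (simp add: x)
    have "\<exists>y \<in> carrier (Wplus n). proj x ` \<Phi> = proj y ` \<Phi>" using x by blast
    then have "\<tau> (proj x ` \<Phi>) = proj (W_bar n y) ` ?\<Phi>0" by (simp only: \<tau>_def y_def if_True)
    moreover have "proj x = proj y"
      using aut_determined[OF proj_closed proj_closed base, of x y] x y by blast
    ultimately show ?thesis using bar_eq[OF x, of y] y by simp
  qed
  have \<tau>_odd: "\<tau> (proj x ` ?\<Phi>0) = proj (W_bar n x) ` \<Phi>" if x: "x \<in> carrier (Wplus n)" for x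
  proof -
    define y where "y = (SOME y. y \<in> carrier (Wplus n) \<and> proj x ` ?\<Phi>0 = proj y ` ?\<Phi>0)"
    have y: "y \<in> carrier (Wplus n) \<and> proj x ` ?\<Phi>0 = proj y ` ?\<Phi>0"
      unfolding y_def by (rule someI[of _ x]) (simp add: x)
    have "\<not> (\<exists>y \<in> carrier (Wplus n). proj x ` ?\<Phi>0 = proj y ` \<Phi>)"
      using even_odd[OF proj_closed proj_closed[OF x]] by metis
    then have "\<tau> (proj x ` ?\<Phi>0) = proj (W_bar n y) ` \<Phi>" by (simp only: \<tau>_def y_def if_False)
    moreover have "proj x = proj y"
      using aut_determined[OF proj_closed proj_closed base0, of x y] x y by blast
    ultimately show ?thesis using bar_eq[OF x, of y] y by simp
  qed
  obtain f where f: "f \<in> carrier (aut_group P)" "\<And>\<Psi>. \<Psi> \<in> flags P \<Longrightarrow> f ` \<Psi> = \<tau> \<Psi>"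
  proof (rule aut_of_flag_involution[of \<tau>])
    fix \<Psi> assume "\<Psi> \<in> flags P"
    \<comment> \<open>\<tau> bars the label and switches the base flag; doing both twice is the
      identity because the bar map is an involution.\<close>
    then show "\<tau> \<Psi> \<in> flags P" "\<tau> (\<tau> \<Psi>) = \<Psi>"
      by (cases rule: flag_cases;
        simp add: \<tau>_even \<tau>_odd W_bar_involution aut_flag[OF proj_closed] base base0)+
  next
    fix \<Psi> i assume "\<Psi> \<in> flags P" and i: "i < n"
    note t = tele_closed[OF i]
    from \<open>\<Psi> \<in> flags P\<close> show "\<tau> (adj P i \<Psi>) = adj P i (\<tau> \<Psi>)"
    proof (cases rule: flag_cases)
      case (1 x)
      \<comment> \<open>An exchange multiplies even labels by \<open>tele i\<close> and odd labels
        by its inverse. The bar map inverts \<open>tele i\<close>, which matches the switch of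
        parity made by \<tau>.\<close>
      have "\<tau> (adj P i \<Psi>) = proj (W_bar n (tele i \<otimes>\<^bsub>Wplus n\<^esub> x)) ` \<Phi>"
        using 1(1) t by (simp only: 1(2) adj_even[OF 1(1) i] \<tau>_odd proj.m_closed)
      also have "\<dots> = proj (inv\<^bsub>Wplus n\<^esub> tele i \<otimes>\<^bsub>Wplus n\<^esub> W_bar n x) ` \<Phi>"
        using 1(1) t by (simp only: bar.hom_mult bar_tele[OF i])
      also have "\<dots> = adj P i (\<tau> \<Psi>)"
        using 1(1) by (simp only: 1(2) \<tau>_even adj_odd[OF bar.hom_closed i])
      finally show ?thesis .
    next
      case (2 x)
      have "\<tau> (adj P i \<Psi>) = proj (W_bar n (inv\<^bsub>Wplus n\<^esub> tele i \<otimes>\<^bsub>Wplus n\<^esub> x)) ` ?\<Phi>0"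
        using 2(1) t by (simp only: 2(2) adj_odd[OF 2(1) i] \<tau>_even proj.m_closed proj.G.inv_closed)
      also have "W_bar n (inv\<^bsub>Wplus n\<^esub> tele i \<otimes>\<^bsub>Wplus n\<^esub> x) = tele i \<otimes>\<^bsub>Wplus n\<^esub> W_bar n x"
        using 2(1) t bar_tele[OF i] by simp
      also have "proj (tele i \<otimes>\<^bsub>Wplus n\<^esub> W_bar n x) ` ?\<Phi>0 = adj P i (\<tau> \<Psi>)"
        using 2(1) by (simp only: 2(2) \<tau>_odd adj_even[OF bar.hom_closed i])
      finally show ?thesis .
    qed
  qed blast
  \<comment> \<open>At the identity label the automorphism \<open>f\<close> takes \<Phi> to its
    0-adjacent flag, which lies in the other orbit.\<close>
  have "f ` \<Phi> = \<tau> (proj \<one>\<^bsub>Wplus n\<^esub> ` \<Phi>)" using f(2)[OF base] image_one[OF base] by simp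
  also have "\<dots> = \<one>\<^bsub>aut_group P\<^esub> ` ?\<Phi>0"
    by (subst \<tau>_even) simp_all
  finally show False using even_odd[OF f(1) aut.one_closed] by simp
qed

end

section \<open>The kernel belonging to the mix\<close>

lemma word_val_subgroup_generated_DirProd:
  assumes G: "group G" and H: "group H"
    and closed: "\<And>s. s \<in> S \<Longrightarrow> f s \<in> carrier G" "\<And>s. s \<in> S \<Longrightarrow> g s \<in> carrier H"
    and w: "w \<in> lists (S \<times> UNIV)"
  shows "word_val (subgroup_generated (G \<times>\<times> H) {(f s, g s) | s. s \<in> S}) (\<lambda>s. (f s, g s)) w =
    (word_val G f w, word_val H g w)"
  using w
proof (induction w)
  case Nil
  then show ?case by simp
next
  case (Cons a w)
  interpret GH: group "G \<times>\<times> H" using G H by (rule DirProd_group)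
  obtain s b where a: "a = (s, b)" by force
  have s: "s \<in> S" using Cons a by auto
  \<comment> \<open>Inverses in the generated subgroup agree with those of the direct product only
    for elements of the subgroup, so membership is needed for the inverse letters.\<close>
  have "(f s, g s) \<in> carrier (subgroup_generated (G \<times>\<times> H) {(f s, g s) | s. s \<in> S})"
    unfolding carrier_subgroup_generated using s closed by (intro generate.incl) auto
  then show ?case
    using Cons a s closed G H by (simp add: GH.inv_subgroup_generated)
qed

text \<open>Words evaluate componentwise in the mix, and the identity of the product is the pair of
  identities; hence the kernel is the intersection.\<close>

lemma W_kernel_mix:
  assumes "group G" "group H"
    and "\<And>i. i \<in> {1..<n} \<Longrightarrow> f i \<in> carrier G" "\<And>i. i \<in> {1..<n} \<Longrightarrow> g i \<in> carrier H"
  shows "W_kernel n (subgroup_generated (G \<times>\<times> H) {(f i, g i) | i. i \<in> {1..<n}}) (\<lambda>i. (f i, g i)) =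
    W_kernel n G f \<inter> W_kernel n H g"
proof -
  let ?GH = "subgroup_generated (G \<times>\<times> H) {(f i, g i) | i. i \<in> {1..<n}}"
  have "presented_hom ?GH (\<lambda>i. (f i, g i)) x = (presented_hom G f x, presented_hom H g x)"
    if x: "x \<in> carrier (Wplus n)" for x
  proof -
    obtain u where u: "u \<in> lists ({1..<n} \<times> UNIV)" "x = word_class {1..<n} (W_relators n) u"
      using x unfolding Wplus_def carrier_presented_group by blast
    then have "u \<in> x" by (simp add: word_class_def word_eq.refl)
    \<comment> \<open>The representative depends on \<open>x\<close> alone, so all three instances
      of \<open>presented_hom\<close> evaluate the same word and no representatives need be
      compared.\<close>
    then have "(SOME w. w \<in> x) \<in> x" by (rule someI)
    then have "(SOME w. w \<in> x) \<in> lists ({1..<n} \<times> UNIV)"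
      using u(2) word_eq_words(2) unfolding word_class_def by blast
    then show ?thesis
      unfolding presented_hom_def
      by (intro word_val_subgroup_generated_DirProd assms)
  qed
  then show ?thesis by (auto simp: W_kernel_def kernel_def)
qed

theorem theorem4p7:
  fixes P :: "'a rel" and Q :: "'b rel" and n :: nat
    and \<Phi> :: "'a set" and \<Psi> :: "'b set"
  assumes "chiral_polytope n P" and "finite (Field P)" and "\<Phi> \<in> flags P"
    and "chiral_polytope n Q" and "finite (Field Q)" and "\<Psi> \<in> flags Q"
    and "simple_group (aut_group Q)"
    and "\<not> chirality_group n P \<Phi> \<cong> aut_group Q"
  shows "mix_chiral n P \<Phi> Q \<Psi>"
proof (rule ccontr)
  interpret P: chiral n P \<Phi>
    using assms by unfold_locales (auto simp: chiral_polytope_def)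
  interpret Q: chiral n Q \<Psi>
    using assms by unfold_locales (auto simp: chiral_polytope_def)
  let ?M = "W_kernel n (aut_group P) (std_rot P \<Phi>)" and ?K = "W_kernel n (aut_group Q) (std_rot Q \<Psi>)"
  assume "\<not> mix_chiral n P \<Phi> Q \<Psi>"
  \<comment> \<open>A mix that is not chiral has a bar-invariant kernel, and this kernel is the
    intersection of the kernels of the two factors.\<close>
  then have "W_bar n ` (?M \<inter> ?K) = ?M \<inter> ?K"
    using W_kernel_mix[of "aut_group P" "aut_group Q" n "std_rot P \<Phi>" "std_rot Q \<Psi>",
        OF P.group_aut Q.group_aut P.std_rot(1) Q.std_rot(1)]
    by (simp add: mix_chiral_def mix_group_def Let_def)
  moreover have "?M \<lhd> Wplus n"
    using P.proj.normal_kernel by (simp add: W_kernel_def)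
  ultimately have "chirality_group n P \<Phi> \<cong> aut_group Q"
    unfolding chirality_group_def Let_def
    using group.chirality_quotient_iso[OF group_Wplus _ Q.proj_group_hom Q.proj_surj assms(7) W_bar_group_hom W_bar_involution
        P.kernel_not_bar_invariant]
    unfolding W_kernel_def by blast
  with assms(8) show False by contradiction
qed

end
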